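(* Let $(\mathcal{C},\mathbb{E},\mathfrak{s})$ be an extriangulated category satisfying Condition (WIC), and let $\xi$ be a proper class of $\mathbb{E}$-triangles such that $\mathcal{C}$ has enough $\xi$-projectives and enough $\xi$-injectives. Let $A\xrightarrow{x}B\xrightarrow{y}C\overset{\delta}{\dashrightarrow}$ be a $\mathcal C(\mathcal{GP}(\xi),-)$-exact $\mathbb E$-triangle in $\xi$. If $A$ has a proper $\xi$-$\mathcal G$projective resolution $\mathbf G_A\to A$ and $C$ has a proper $\xi$-$\mathcal G$projective resolution $\mathbf G_C\to C$, then there are a proper $\xi$-$\mathcal G$projective resolution $\mathbf G_B\to B$ and chain maps $x^\bullet:\mathbf G_A\to\mathbf G_B$, $y^\bullet:\mathbf G_B\to\mathbf G_C$ making the diagram with rows $\mathbf G_A\xrightarrow{x^\bullet}\mathbf G_B\xrightarrow{y^\bullet}\mathbf G_C$ and $A\xrightarrow{x}B\xrightarrow{y}C$, and with the resolution maps as vertical arrows, commutative. Moreover, for every $n\geqslant0$, $G^n_A\xrightarrow{x^n}G^n_B\xrightarrow{y^n}G^n_C\dashrightarrow$ is a split $\mathbb E$-triangle, i.e. $G^n_B\simeq G^n_A\oplus G^n_C$.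
   Context: Extriangulated category: an additive category $\mathcal C$ with (ET1) a biadditive functor $\mathbb E:\mathcal C^{op}\times\mathcal C\to\mathbf{Ab}$ and a correspondence $\mathfrak s$ sending each $\delta\in\mathbb E(C,A)$ to a class $[A\xrightarrow{x}B\xrightarrow{y}C]$ of sequences modulo isomorphisms that are the identity on $A$ and $C$. Write $a_*\delta=\mathbb E(C,a)(\delta)$, $c^*\delta=\mathbb E(c,A)(\delta)$; a morphism from $\delta\in\mathbb E(C,A)$ to $\delta'\in\mathbb E(C',A')$ is a pair $(a:A\to A',c:C\to C')$ with $a_*\delta=c^*\delta'$. Axioms: (ET2) every morphism $(a,c)$ of extensions is realized by some $b$ making both squares between the realizing sequences commute, $\mathfrak s(0)=[A\to A\oplus C\to C]$, and $\mathfrak s(\delta\oplus\delta')=\mathfrak s(\delta)\oplus\mathfrak s(\delta')$; (ET3) if $\mathfrak s(\delta)=[A\xrightarrow{x}B\xrightarrow{y}C]$, $\mathfrak s(\delta')=[A'\xrightarrow{x'}B'\xrightarrow{y'}C']$ and $bx=x'a$, there is $c$ with $cy=y'b$ and $(a,c):\delta\to\delta'$ a morphism; (ET4) if $\delta\in\mathbb E(D,A)$, $\delta'\in\mathbb E(F,B)$ are realized by $A\xrightarrow{f}B\xrightarrow{f'}D$ and $B\xrightarrow{g}C\xrightarrow{g'}F$, there are an object $E$, $\delta''\in\mathbb E(E,A)$ realized by $A\xrightarrow{gf}C\xrightarrow{h'}E$, and $D\xrightarrow{d}E\xrightarrow{e}F$ realizing $f'_*\delta'$, with $h'g=df'$,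 $eh'=g'$, $d^*\delta''=\delta$, $f_*\delta''=e^*\delta'$; and the duals (ET3)$^{op}$, (ET4)$^{op}$. If $\mathfrak s(\delta)=[A\xrightarrow{x}B\xrightarrow{y}C]$, then $A\xrightarrow{x}B\xrightarrow{y}C\overset{\delta}{\dashrightarrow}$ is called an $\mathbb E$-triangle, $x$ an inflation, $y$ a deflation; it is split if $\delta=0$. Condition (WIC): for composable $f,g$, if $gf$ is an inflation so is $f$; if $gf$ is a deflation so is $g$. Proper class: a class $\xi$ of $\mathbb E$-triangles closed under isomorphisms such that (1) $\xi$ contains the split $\mathbb E$-triangles and is closed under finite coproducts; (2) if $A\to B\to C\overset{\delta}{\dashrightarrow}$ is in $\xi$, so is every $\mathbb E$-triangle realizing $c^*\delta$ or $a_*\delta$, for any $c:C'\to C$, $a:A\to A'$; (3) (saturated) for $\mathbb E$-triangles $A_i\xrightarrow{x_i}B_i\xrightarrow{y_i}C\overset{\delta_i}{\dashrightarrow}$, $i=1,2$, if the second one and the $\mathbb E$-triangle $A_1\to M\to B_2\overset{y_2^*\delta_1}{\dashrightarrow}$ are in $\xi$, then the first one is in $\xi$. $P$ is $\xi$-projective if $0\to\mathcal C(P,A)\to\mathcal C(P,B)\to\mathcal C(P,C)\to0$ is exact for every $\mathbb E$-triangle $A\to B\to C\dashrightarrow$ in $\xi$; $\xi$-injective is dual. $\mathcal P(\xi)$, $\mathcal I(\xi)$ denote the corresponding classes. Enough $\xi$-projectives: each $A$ admits an $\mathbb E$-triangle $K\to P\to A\dashrightarrow$ in $\xi$ with $P\in\mathcal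 P(\xi)$; enough $\xi$-injectives is dual. For a class $\mathcal W$, an $\mathbb E$-triangle $A\to B\to C\dashrightarrow$ in $\xi$ is $\mathcal C(\mathcal W,-)$-exact if $0\to\mathcal C(W,A)\to\mathcal C(W,B)\to\mathcal C(W,C)\to0$ is exact for all $W\in\mathcal W$, and $\mathcal C(-,\mathcal W)$-exact if $0\to\mathcal C(C,W)\to\mathcal C(B,W)\to\mathcal C(A,W)\to0$ is exact for all $W\in\mathcal W$. A complex $\cdots\to X_1\xrightarrow{d_1}X_0\xrightarrow{d_0}X_{-1}\to\cdots$ is $\xi$-exact if there are $\mathbb E$-triangles $K_{n+1}\xrightarrow{g_n}X_n\xrightarrow{f_n}K_n\dashrightarrow$ in $\xi$ (resolution $\mathbb E$-triangles) with $d_n=g_{n-1}f_n$ for all $n$. A complete $\xi$-projective resolution is a $\xi$-exact complex of $\xi$-projectives whose resolution $\mathbb E$-triangles are $\mathcal C(-,\mathcal P(\xi))$-exact; the objects $K_n$ occurring are called $\xi$-$\mathcal G$projective, forming $\mathcal{GP}(\xi)$. A proper $\xi$-$\mathcal G$projective resolution $\mathbf G\to A$ of $A$ is a $\xi$-exact complex $\cdots\to G_1\to G_0\to A\to0$ with all $G_i\in\mathcal{GP}(\xi)$ whose resolution $\mathbb E$-triangles $K_{i+1}\to G_i\to K_i\dashrightarrow$ ($K_0=A$) are $\mathcal C(\mathcal{GP}(\xi),-)$-exact. The degree-$n$ term of $\mathbf G_A$ is written $G_A^n$. *)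

theory Defs
  imports "HOL-Algebra.Exact_Sequence"
begin

text \<open>
  Hom-groups and extension groups are abelian groups in the sense of HOL-Algebra, written
  multiplicatively: in \<open>Hom \<C> A B\<close> and \<open>Ext \<C> C A\<close> the zero element is \<open>\<one>\<close> and the
  sum is \<open>\<otimes>\<close>. Composition is \<open>g \<cdot> f\<close> (first \<open>f\<close>, then \<open>g\<close>). Hom-sets between different pairs of
  objects are not assumed disjoint, so domains and codomains are always carried explicitly.
\<close>

record ('o, 'm) cat =
  Ob :: "'o set"
  Hom :: "'o \<Rightarrow> 'o \<Rightarrow> 'm monoid"
  idn :: "'o \<Rightarrow> 'm"
  cmp :: "'m \<Rightarrow> 'm \<Rightarrow> 'm"  (infixr "\<cdot>\<index>" 75)

text \<open>
  \<open>Emap \<C> c a\<close> is the homomorphism \<open>E(c, a)\<close> of the bifunctor (contravariant in \<open>c\<close>, covariant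
  in \<open>a\<close>). \<open>Real \<C> C A \<delta>\<close> is the class of all triples \<open>(x, B, y)\<close>, standing for
  \<open>A \<rightarrow> B \<rightarrow> C\<close>, that realize \<open>\<delta>\<close>.
\<close>

record ('o, 'm, 'e) extri_cat = "('o, 'm) cat" +
  Ext :: "'o \<Rightarrow> 'o \<Rightarrow> 'e monoid"
  Emap :: "'m \<Rightarrow> 'm \<Rightarrow> 'e \<Rightarrow> 'e"
  Real :: "'o \<Rightarrow> 'o \<Rightarrow> 'e \<Rightarrow> ('m \<times> 'o \<times> 'm) set"

text \<open>A tuple \<open>(A, x, B, y, C, \<delta>)\<close> stands for \<open>A \<rightarrow> B \<rightarrow> C\<close> with maps \<open>x\<close>, \<open>y\<close> and \<open>\<delta> \<in> E(C, A)\<close>.\<close>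

type_synonym ('o, 'm, 'e) tri = "'o \<times> 'm \<times> 'o \<times> 'm \<times> 'o \<times> 'e"

abbreviation mor :: "('o, 'm, 'z) cat_scheme \<Rightarrow> 'o \<Rightarrow> 'o \<Rightarrow> 'm set" where
  "mor \<C> A B \<equiv> carrier (Hom \<C> A B)"

abbreviation ext :: "('o, 'm, 'e) extri_cat \<Rightarrow> 'o \<Rightarrow> 'o \<Rightarrow> 'e set" where
  "ext \<C> C A \<equiv> carrier (Ext \<C> C A)"


section \<open>Additive categories\<close>

context
  fixes \<C> :: "('o, 'm, 'z) cat_scheme" (structure)
begin

definition iso_mor :: "'o \<Rightarrow> 'o \<Rightarrow> 'm \<Rightarrow> bool" where
  "iso_mor A B f \<longleftrightarrow> f \<in> mor \<C> A B \<and>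
     (\<exists>g \<in> mor \<C> B A. g \<cdot> f = idn \<C> A \<and> f \<cdot> g = idn \<C> B)"

definition isomorphic :: "'o \<Rightarrow> 'o \<Rightarrow> bool" where
  "isomorphic A B \<longleftrightarrow> (\<exists>f. iso_mor A B f)"

definition zero_obj :: "'o \<Rightarrow> bool" where
  "zero_obj Z \<longleftrightarrow> Z \<in> Ob \<C> \<and>
     (\<forall>A \<in> Ob \<C>. trivial_group (Hom \<C> Z A) \<and> trivial_group (Hom \<C> A Z))"

text \<open>\<open>P = A \<oplus> B\<close> with injections \<open>i\<close>, \<open>j\<close> and projections \<open>p\<close>, \<open>q\<close>.\<close>

definition biproduct :: "'o \<Rightarrow> 'o \<Rightarrow> 'o \<Rightarrow> 'm \<Rightarrow> 'm \<Rightarrow> 'm \<Rightarrow> 'm \<Rightarrow> bool" where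
  "biproduct A B P i p j q \<longleftrightarrow>
     P \<in> Ob \<C> \<and> i \<in> mor \<C> A P \<and> p \<in> mor \<C> P A \<and> j \<in> mor \<C> B P \<and> q \<in> mor \<C> P B \<and>
     p \<cdot> i = idn \<C> A \<and> q \<cdot> j = idn \<C> B \<and>
     p \<cdot> j = \<one>\<^bsub>Hom \<C> B A\<^esub> \<and> q \<cdot> i = \<one>\<^bsub>Hom \<C> A B\<^esub> \<and>
     (i \<cdot> p) \<otimes>\<^bsub>Hom \<C> P P\<^esub> (j \<cdot> q) = idn \<C> P"

text \<open>
  \<open>u \<oplus> u' : S \<rightarrow> T\<close>, where \<open>p\<close>, \<open>q\<close> are the projections of the biproduct \<open>S\<close> and \<open>i\<close>, \<open>j\<close> the
  injections of the biproduct \<open>T\<close>.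
\<close>

definition sum_mor :: "'o \<Rightarrow> 'm \<Rightarrow> 'm \<Rightarrow> 'o \<Rightarrow> 'm \<Rightarrow> 'm \<Rightarrow> 'm \<Rightarrow> 'm \<Rightarrow> 'm" where
  "sum_mor S p q T i j u u' = (i \<cdot> u \<cdot> p) \<otimes>\<^bsub>Hom \<C> S T\<^esub> (j \<cdot> u' \<cdot> q)"

end

locale additive_category =
  fixes \<C> :: "('o, 'm, 'z) cat_scheme" (structure)
  assumes hom_group: "\<lbrakk>A \<in> Ob \<C>; B \<in> Ob \<C>\<rbrakk> \<Longrightarrow> comm_group (Hom \<C> A B)"
    and idn_mor: "A \<in> Ob \<C> \<Longrightarrow> idn \<C> A \<in> mor \<C> A A"
    and cmp_mor: "\<lbrakk>A \<in> Ob \<C>; B \<in> Ob \<C>; C \<in> Ob \<C>; f \<in> mor \<C> A B; g \<in> mor \<C> B C\<rbrakk>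
      \<Longrightarrow> g \<cdot> f \<in> mor \<C> A C"
    and idn_left: "\<lbrakk>A \<in> Ob \<C>; B \<in> Ob \<C>; f \<in> mor \<C> A B\<rbrakk> \<Longrightarrow> idn \<C> B \<cdot> f = f"
    and idn_right: "\<lbrakk>A \<in> Ob \<C>; B \<in> Ob \<C>; f \<in> mor \<C> A B\<rbrakk> \<Longrightarrow> f \<cdot> idn \<C> A = f"
    and cmp_assoc: "\<lbrakk>A \<in> Ob \<C>; B \<in> Ob \<C>; C \<in> Ob \<C>; D \<in> Ob \<C>;
        f \<in> mor \<C> A B; g \<in> mor \<C> B C; h \<in> mor \<C> C D\<rbrakk> \<Longrightarrow> (h \<cdot> g) \<cdot> f = h \<cdot> (g \<cdot> f)"
    and cmp_add_right: "\<lbrakk>A \<in> Ob \<C>; B \<in> Ob \<C>; C \<in> Ob \<C>; f \<in> mor \<C> A B; f' \<in> mor \<C> A B; g \<in> mor \<C> B C\<rbrakk>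
      \<Longrightarrow> g \<cdot> (f \<otimes>\<^bsub>Hom \<C> A B\<^esub> f') = (g \<cdot> f) \<otimes>\<^bsub>Hom \<C> A C\<^esub> (g \<cdot> f')"
    and cmp_add_left: "\<lbrakk>A \<in> Ob \<C>; B \<in> Ob \<C>; C \<in> Ob \<C>; f \<in> mor \<C> A B; g \<in> mor \<C> B C; g' \<in> mor \<C> B C\<rbrakk>
      \<Longrightarrow> (g \<otimes>\<^bsub>Hom \<C> B C\<^esub> g') \<cdot> f = (g \<cdot> f) \<otimes>\<^bsub>Hom \<C> A C\<^esub> (g' \<cdot> f)"
    and zero_exists: "\<exists>Z. zero_obj \<C> Z"
    and biproduct_exists: "\<lbrakk>A \<in> Ob \<C>; B \<in> Ob \<C>\<rbrakk> \<Longrightarrow> \<exists>P i p j q. biproduct \<C> A B P i p j q"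


section \<open>Extriangulated categories\<close>

context
  fixes \<C> :: "('o, 'm, 'e) extri_cat" (structure)
begin

text \<open>\<open>a\<^sub>*\<delta> = E(C, a)(\<delta>)\<close> and \<open>c\<^sup>*\<delta> = E(c, A)(\<delta>)\<close>, for \<open>\<delta> \<in> E(C, A)\<close>.\<close>

definition push :: "'o \<Rightarrow> 'm \<Rightarrow> 'e \<Rightarrow> 'e" where
  "push C a \<delta> = Emap \<C> (idn \<C> C) a \<delta>"

definition pull :: "'m \<Rightarrow> 'o \<Rightarrow> 'e \<Rightarrow> 'e" where
  "pull c A \<delta> = Emap \<C> c (idn \<C> A) \<delta>"

definition ext_morphism :: "'o \<Rightarrow> 'o \<Rightarrow> 'e \<Rightarrow> 'o \<Rightarrow> 'o \<Rightarrow> 'e \<Rightarrow> 'm \<Rightarrow> 'm \<Rightarrow> bool" where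
  "ext_morphism C A \<delta> C' A' \<delta>' a c \<longleftrightarrow>
     a \<in> mor \<C> A A' \<and> c \<in> mor \<C> C C' \<and> push C a \<delta> = pull c A' \<delta>'"

text \<open>
  \<open>\<delta> \<oplus> \<delta>' \<in> E(S, T)\<close>, where \<open>p\<close>, \<open>q\<close> are the projections of the biproduct \<open>S = C \<oplus> C'\<close> and \<open>i\<close>, \<open>j\<close>
  the injections of \<open>T = A \<oplus> A'\<close>: the element corresponding to \<open>(\<delta>, 0, 0, \<delta>')\<close> under the
  decomposition of \<open>E(C \<oplus> C', A \<oplus> A')\<close> into \<open>E(C, A)\<close>, \<open>E(C, A')\<close>, \<open>E(C', A)\<close>, \<open>E(C', A')\<close>
  given by biadditivity.
\<close>

definition sum_ext :: "'o \<Rightarrow> 'm \<Rightarrow> 'm \<Rightarrow> 'o \<Rightarrow> 'm \<Rightarrow> 'm \<Rightarrow> 'e \<Rightarrow> 'e \<Rightarrow> 'e" where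
  "sum_ext S p q T i j \<delta> \<delta>' = Emap \<C> p i \<delta> \<otimes>\<^bsub>Ext \<C> S T\<^esub> Emap \<C> q j \<delta>'"

definition seqs :: "'o \<Rightarrow> 'o \<Rightarrow> ('m \<times> 'o \<times> 'm) set" where
  "seqs A C = {(x, B, y). B \<in> Ob \<C> \<and> x \<in> mor \<C> A B \<and> y \<in> mor \<C> B C}"

definition seq_equiv :: "'o \<Rightarrow> 'o \<Rightarrow> (('m \<times> 'o \<times> 'm) \<times> ('m \<times> 'o \<times> 'm)) set" where
  "seq_equiv A C =
     {((x, B, y), (x', B', y')). (x, B, y) \<in> seqs A C \<and> (x', B', y') \<in> seqs A C \<and>
        (\<exists>b. iso_mor \<C> B B' b \<and> b \<cdot> x = x' \<and> y' \<cdot> b = y)}"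

definition etriangles :: "('o, 'm, 'e) tri set" where
  "etriangles = {(A, x, B, y, C, \<delta>).
     A \<in> Ob \<C> \<and> B \<in> Ob \<C> \<and> C \<in> Ob \<C> \<and> \<delta> \<in> ext \<C> C A \<and> (x, B, y) \<in> Real \<C> C A \<delta>}"

definition split :: "('o, 'm, 'e) tri \<Rightarrow> bool" where
  "split = (\<lambda>(A, x, B, y, C, \<delta>). \<delta> = \<one>\<^bsub>Ext \<C> C A\<^esub>)"

definition inflation :: "'o \<Rightarrow> 'o \<Rightarrow> 'm \<Rightarrow> bool" where
  "inflation A B x \<longleftrightarrow> (\<exists>y C \<delta>. (A, x, B, y, C, \<delta>) \<in> etriangles)"

definition deflation :: "'o \<Rightarrow> 'o \<Rightarrow> 'm \<Rightarrow> bool" where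
  "deflation B C y \<longleftrightarrow> (\<exists>A x \<delta>. (A, x, B, y, C, \<delta>) \<in> etriangles)"

definition WIC :: bool where
  "WIC \<longleftrightarrow> (\<forall>A \<in> Ob \<C>. \<forall>B \<in> Ob \<C>. \<forall>C \<in> Ob \<C>. \<forall>f \<in> mor \<C> A B. \<forall>g \<in> mor \<C> B C.
     (inflation A C (g \<cdot> f) \<longrightarrow> inflation A B f) \<and>
     (deflation A C (g \<cdot> f) \<longrightarrow> deflation B C g))"

definition tri_iso :: "('o, 'm, 'e) tri \<Rightarrow> ('o, 'm, 'e) tri \<Rightarrow> bool" where
  "tri_iso = (\<lambda>(A, x, B, y, C, \<delta>) (A', x', B', y', C', \<delta>').
     \<exists>a b c. iso_mor \<C> A A' a \<and> iso_mor \<C> B B' b \<and> iso_mor \<C> C C' c \<and>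
       b \<cdot> x = x' \<cdot> a \<and> c \<cdot> y = y' \<cdot> b \<and> ext_morphism C A \<delta> C' A' \<delta>' a c)"

end

locale extriangulated_category = additive_category \<C>
  for \<C> :: "('o, 'm, 'e) extri_cat" (structure) +
  assumes ext_group: "\<lbrakk>C \<in> Ob \<C>; A \<in> Ob \<C>\<rbrakk> \<Longrightarrow> comm_group (Ext \<C> C A)"
    and Emap_hom: "\<lbrakk>A \<in> Ob \<C>; A' \<in> Ob \<C>; C \<in> Ob \<C>; C' \<in> Ob \<C>; a \<in> mor \<C> A A'; c \<in> mor \<C> C' C\<rbrakk>
      \<Longrightarrow> Emap \<C> c a \<in> hom (Ext \<C> C A) (Ext \<C> C' A')"
    and Emap_idn: "\<lbrakk>A \<in> Ob \<C>; C \<in> Ob \<C>; \<delta> \<in> ext \<C> C A\<rbrakk> \<Longrightarrow> Emap \<C> (idn \<C> C) (idn \<C> A) \<delta> = \<delta>"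
    and Emap_cmp: "\<lbrakk>A \<in> Ob \<C>; A' \<in> Ob \<C>; A'' \<in> Ob \<C>; C \<in> Ob \<C>; C' \<in> Ob \<C>; C'' \<in> Ob \<C>;
        a \<in> mor \<C> A A'; a' \<in> mor \<C> A' A''; c \<in> mor \<C> C' C; c' \<in> mor \<C> C'' C'; \<delta> \<in> ext \<C> C A\<rbrakk>
      \<Longrightarrow> Emap \<C> (c \<cdot> c') (a' \<cdot> a) \<delta> = Emap \<C> c' a' (Emap \<C> c a \<delta>)"
    and Emap_add_cov: "\<lbrakk>A \<in> Ob \<C>; A' \<in> Ob \<C>; C \<in> Ob \<C>; C' \<in> Ob \<C>;
        a \<in> mor \<C> A A'; a' \<in> mor \<C> A A'; c \<in> mor \<C> C' C; \<delta> \<in> ext \<C> C A\<rbrakk>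
      \<Longrightarrow> Emap \<C> c (a \<otimes>\<^bsub>Hom \<C> A A'\<^esub> a') \<delta> = Emap \<C> c a \<delta> \<otimes>\<^bsub>Ext \<C> C' A'\<^esub> Emap \<C> c a' \<delta>"
    and Emap_add_contra: "\<lbrakk>A \<in> Ob \<C>; A' \<in> Ob \<C>; C \<in> Ob \<C>; C' \<in> Ob \<C>;
        a \<in> mor \<C> A A'; c \<in> mor \<C> C' C; c' \<in> mor \<C> C' C; \<delta> \<in> ext \<C> C A\<rbrakk>
      \<Longrightarrow> Emap \<C> (c \<otimes>\<^bsub>Hom \<C> C' C\<^esub> c') a \<delta> = Emap \<C> c a \<delta> \<otimes>\<^bsub>Ext \<C> C' A'\<^esub> Emap \<C> c' a \<delta>"
    and Real_class: "\<lbrakk>A \<in> Ob \<C>; C \<in> Ob \<C>; \<delta> \<in> ext \<C> C A\<rbrakk>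
      \<Longrightarrow> Real \<C> C A \<delta> \<in> seqs \<C> A C // seq_equiv \<C> A C"
    and ET2_realize: "\<lbrakk>(A, x, B, y, C, \<delta>) \<in> etriangles \<C>; (A', x', B', y', C', \<delta>') \<in> etriangles \<C>;
        ext_morphism \<C> C A \<delta> C' A' \<delta>' a c\<rbrakk>
      \<Longrightarrow> \<exists>b \<in> mor \<C> B B'. b \<cdot> x = x' \<cdot> a \<and> y' \<cdot> b = c \<cdot> y"
    and ET2_zero: "\<lbrakk>A \<in> Ob \<C>; C \<in> Ob \<C>; biproduct \<C> A C P i p j q\<rbrakk>
      \<Longrightarrow> (i, P, q) \<in> Real \<C> C A \<one>\<^bsub>Ext \<C> C A\<^esub>"
    and ET2_sum: "\<lbrakk>(A, x, B, y, C, \<delta>) \<in> etriangles \<C>; (A', x', B', y', C', \<delta>') \<in> etriangles \<C>;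
        biproduct \<C> A A' SA iA pA jA qA; biproduct \<C> B B' SB iB pB jB qB;
        biproduct \<C> C C' SC iC pC jC qC\<rbrakk>
      \<Longrightarrow> (sum_mor \<C> SA pA qA SB iB jB x x', SB, sum_mor \<C> SB pB qB SC iC jC y y')
            \<in> Real \<C> SC SA (sum_ext \<C> SC pC qC SA iA jA \<delta> \<delta>')"
    and ET3: "\<lbrakk>(A, x, B, y, C, \<delta>) \<in> etriangles \<C>; (A', x', B', y', C', \<delta>') \<in> etriangles \<C>;
        a \<in> mor \<C> A A'; b \<in> mor \<C> B B'; b \<cdot> x = x' \<cdot> a\<rbrakk>
      \<Longrightarrow> \<exists>c. c \<cdot> y = y' \<cdot> b \<and> ext_morphism \<C> C A \<delta> C' A' \<delta>' a c"
    and ET3_op: "\<lbrakk>(A, x, B, y, C, \<delta>) \<in> etriangles \<C>; (A', x', B', y', C', \<delta>') \<in> etriangles \<C>;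
        b \<in> mor \<C> B B'; c \<in> mor \<C> C C'; c \<cdot> y = y' \<cdot> b\<rbrakk>
      \<Longrightarrow> \<exists>a. b \<cdot> x = x' \<cdot> a \<and> ext_morphism \<C> C A \<delta> C' A' \<delta>' a c"
    and ET4: "\<lbrakk>(A, f, B, f', D, \<delta>) \<in> etriangles \<C>; (B, g, C, g', F, \<delta>') \<in> etriangles \<C>\<rbrakk>
      \<Longrightarrow> \<exists>E h' d e \<delta>''.
            (A, g \<cdot> f, C, h', E, \<delta>'') \<in> etriangles \<C> \<and>
            (D, d, E, e, F, push \<C> F f' \<delta>') \<in> etriangles \<C> \<and>
            h' \<cdot> g = d \<cdot> f' \<and> e \<cdot> h' = g' \<and>
            pull \<C> d A \<delta>'' = \<delta> \<and> push \<C> E f \<delta>'' = pull \<C> e B \<delta>'"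
    and ET4_op: "\<lbrakk>(D, f', B, f, A, \<delta>) \<in> etriangles \<C>; (F, g', C, g, B, \<delta>') \<in> etriangles \<C>\<rbrakk>
      \<Longrightarrow> \<exists>E h' d e \<delta>''.
            (E, h', C, f \<cdot> g, A, \<delta>'') \<in> etriangles \<C> \<and>
            (F, e, E, d, D, pull \<C> f' F \<delta>') \<in> etriangles \<C> \<and>
            g \<cdot> h' = f' \<cdot> d \<and> h' \<cdot> e = g' \<and>
            push \<C> A d \<delta>'' = \<delta> \<and> pull \<C> f E \<delta>'' = push \<C> B e \<delta>'"


section \<open>Proper classes\<close>

text \<open>
  Closure under the empty coproduct is contained in \<open>contains_split\<close>, so closure under finite
  coproducts is stated for binary ones.
\<close>

locale proper_class = extriangulated_category \<C>
  for \<C> :: "('o, 'm, 'e) extri_cat" (structure) +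
  fixes \<xi> :: "('o, 'm, 'e) tri set"
  assumes etriangle: "\<xi> \<subseteq> etriangles \<C>"
    and iso_closed: "\<lbrakk>T \<in> \<xi>; T' \<in> etriangles \<C>; tri_iso \<C> T T'\<rbrakk> \<Longrightarrow> T' \<in> \<xi>"
    and contains_split: "\<lbrakk>T \<in> etriangles \<C>; split \<C> T\<rbrakk> \<Longrightarrow> T \<in> \<xi>"
    and coproduct_closed: "\<lbrakk>(A, x, B, y, C, \<delta>) \<in> \<xi>; (A', x', B', y', C', \<delta>') \<in> \<xi>;
        biproduct \<C> A A' SA iA pA jA qA; biproduct \<C> B B' SB iB pB jB qB;
        biproduct \<C> C C' SC iC pC jC qC\<rbrakk>
      \<Longrightarrow> (SA, sum_mor \<C> SA pA qA SB iB jB x x', SB, sum_mor \<C> SB pB qB SC iC jC y y', SC,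
            sum_ext \<C> SC pC qC SA iA jA \<delta> \<delta>') \<in> \<xi>"
    and base_change: "\<lbrakk>(A, x, B, y, C, \<delta>) \<in> \<xi>; C' \<in> Ob \<C>; c \<in> mor \<C> C' C;
        (A, x', B', y', C', pull \<C> c A \<delta>) \<in> etriangles \<C>\<rbrakk>
      \<Longrightarrow> (A, x', B', y', C', pull \<C> c A \<delta>) \<in> \<xi>"
    and cobase_change: "\<lbrakk>(A, x, B, y, C, \<delta>) \<in> \<xi>; A' \<in> Ob \<C>; a \<in> mor \<C> A A';
        (A', x', B', y', C, push \<C> C a \<delta>) \<in> etriangles \<C>\<rbrakk>
      \<Longrightarrow> (A', x', B', y', C, push \<C> C a \<delta>) \<in> \<xi>"
    and saturated: "\<lbrakk>(A1, x1, B1, y1, C, \<delta>1) \<in> etriangles \<C>; (A2, x2, B2, y2, C, \<delta>2) \<in> \<xi>;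
        (A1, m, M, e, B2, pull \<C> y2 A1 \<delta>1) \<in> \<xi>\<rbrakk>
      \<Longrightarrow> (A1, x1, B1, y1, C, \<delta>1) \<in> \<xi>"


section \<open>Relative projectives, injectives and Gorenstein projectives\<close>

context
  fixes \<C> :: "('o, 'm, 'e) extri_cat" (structure)
begin

text \<open>
  Exactness of \<open>0 \<rightarrow> \<C>(W,A) \<rightarrow> \<C>(W,B) \<rightarrow> \<C>(W,C) \<rightarrow> 0\<close> and of
  \<open>0 \<rightarrow> \<C>(C,W) \<rightarrow> \<C>(B,W) \<rightarrow> \<C>(A,W) \<rightarrow> 0\<close>. The arguments of \<open>short_exact_sequence\<close> are
  listed from the last group to the first.
\<close>

definition cov_exact :: "'o \<Rightarrow> ('o, 'm, 'e) tri \<Rightarrow> bool" where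
  "cov_exact W = (\<lambda>(A, x, B, y, C, \<delta>).
     short_exact_sequence (Hom \<C> W C) (Hom \<C> W B) (Hom \<C> W A) (\<lambda>f. y \<cdot> f) (\<lambda>f. x \<cdot> f))"

definition contra_exact :: "'o \<Rightarrow> ('o, 'm, 'e) tri \<Rightarrow> bool" where
  "contra_exact W = (\<lambda>(A, x, B, y, C, \<delta>).
     short_exact_sequence (Hom \<C> A W) (Hom \<C> B W) (Hom \<C> C W) (\<lambda>f. f \<cdot> x) (\<lambda>f. f \<cdot> y))"

end

context
  fixes \<C> :: "('o, 'm, 'e) extri_cat" (structure) and \<xi> :: "('o, 'm, 'e) tri set"
begin

definition Proj :: "'o set" where
  "Proj = {P \<in> Ob \<C>. \<forall>T \<in> \<xi>. cov_exact \<C> P T}"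

definition Inj :: "'o set" where
  "Inj = {I \<in> Ob \<C>. \<forall>T \<in> \<xi>. contra_exact \<C> I T}"

definition enough_projectives :: bool where
  "enough_projectives \<longleftrightarrow>
     (\<forall>A \<in> Ob \<C>. \<exists>K k P p \<delta>. P \<in> Proj \<and> (K, k, P, p, A, \<delta>) \<in> \<xi>)"

definition enough_injectives :: bool where
  "enough_injectives \<longleftrightarrow>
     (\<forall>A \<in> Ob \<C>. \<exists>i I k K \<delta>. I \<in> Inj \<and> (A, i, I, k, K, \<delta>) \<in> \<xi>)"

text \<open>
  Complexes are indexed by \<open>int\<close> with \<open>d n : X n \<rightarrow> X (n - 1)\<close>. In
  \<open>resolution_triangles X d K g f \<kappa>\<close> the data \<open>K\<close>, \<open>g\<close>, \<open>f\<close>, \<open>\<kappa>\<close> are the resolution triangles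
  exhibiting \<open>(X, d)\<close> as a \<open>\<xi>\<close>-exact complex.
\<close>

definition chain_complex :: "(int \<Rightarrow> 'o) \<Rightarrow> (int \<Rightarrow> 'm) \<Rightarrow> bool" where
  "chain_complex X d \<longleftrightarrow>
     (\<forall>n. X n \<in> Ob \<C> \<and> d n \<in> mor \<C> (X n) (X (n - 1)) \<and>
          d (n - 1) \<cdot> d n = \<one>\<^bsub>Hom \<C> (X n) (X (n - 2))\<^esub>)"

definition resolution_triangles ::
  "(int \<Rightarrow> 'o) \<Rightarrow> (int \<Rightarrow> 'm) \<Rightarrow> (int \<Rightarrow> 'o) \<Rightarrow> (int \<Rightarrow> 'm) \<Rightarrow> (int \<Rightarrow> 'm) \<Rightarrow> (int \<Rightarrow> 'e) \<Rightarrow> bool" where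
  "resolution_triangles X d K g f \<kappa> \<longleftrightarrow>
     (\<forall>n. (K (n + 1), g n, X n, f n, K n, \<kappa> n) \<in> \<xi> \<and> d n = g (n - 1) \<cdot> f n)"

definition complete_projective_resolution ::
  "(int \<Rightarrow> 'o) \<Rightarrow> (int \<Rightarrow> 'm) \<Rightarrow> (int \<Rightarrow> 'o) \<Rightarrow> (int \<Rightarrow> 'm) \<Rightarrow> (int \<Rightarrow> 'm) \<Rightarrow> (int \<Rightarrow> 'e) \<Rightarrow> bool" where
  "complete_projective_resolution X d K g f \<kappa> \<longleftrightarrow>
     chain_complex X d \<and> resolution_triangles X d K g f \<kappa> \<and> (\<forall>n. X n \<in> Proj) \<and>
     (\<forall>n. \<forall>W \<in> Proj. contra_exact \<C> W (K (n + 1), g n, X n, f n, K n, \<kappa> n))"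

definition GProj :: "'o set" where
  "GProj = {G. \<exists>X d K g f \<kappa> n. complete_projective_resolution X d K g f \<kappa> \<and> G = K n}"

text \<open>
  A resolution \<open>\<dots> \<rightarrow> G 1 \<rightarrow> G 0 \<rightarrow> A \<rightarrow> 0\<close> is given by its terms and by its maps
  \<open>d (Suc n) : G (Suc n) \<rightarrow> G n\<close>, where \<open>d 0 : G 0 \<rightarrow> A\<close> is the resolution map.
\<close>

definition augmented_complex :: "'o \<Rightarrow> (nat \<Rightarrow> 'o) \<Rightarrow> (nat \<Rightarrow> 'm) \<Rightarrow> bool" where
  "augmented_complex A G d \<longleftrightarrow>
     A \<in> Ob \<C> \<and> (\<forall>n. G n \<in> Ob \<C>) \<and>
     d 0 \<in> mor \<C> (G 0) A \<and> (\<forall>n. d (Suc n) \<in> mor \<C> (G (Suc n)) (G n)) \<and>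
     d 0 \<cdot> d 1 = \<one>\<^bsub>Hom \<C> (G 1) A\<^esub> \<and>
     (\<forall>n. d (Suc n) \<cdot> d (Suc (Suc n)) = \<one>\<^bsub>Hom \<C> (G (Suc (Suc n))) (G n)\<^esub>)"

definition proper_GProj_resolution :: "'o \<Rightarrow> (nat \<Rightarrow> 'o) \<Rightarrow> (nat \<Rightarrow> 'm) \<Rightarrow> bool" where
  "proper_GProj_resolution A G d \<longleftrightarrow>
     augmented_complex A G d \<and> (\<forall>n. G n \<in> GProj) \<and>
     (\<exists>K g f \<kappa>. K 0 = A \<and> d 0 = f 0 \<and> (\<forall>n. d (Suc n) = g n \<cdot> f (Suc n)) \<and>
        (\<forall>n. (K (Suc n), g n, G n, f n, K n, \<kappa> n) \<in> \<xi> \<and>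
             (\<forall>W \<in> GProj. cov_exact \<C> W (K (Suc n), g n, G n, f n, K n, \<kappa> n))))"

end

definition chain_map ::
  "('o, 'm, 'e) extri_cat \<Rightarrow> (nat \<Rightarrow> 'o) \<Rightarrow> (nat \<Rightarrow> 'm) \<Rightarrow> (nat \<Rightarrow> 'o) \<Rightarrow> (nat \<Rightarrow> 'm) \<Rightarrow> (nat \<Rightarrow> 'm) \<Rightarrow> bool" where
  "chain_map \<C> G d G' d' \<phi> \<longleftrightarrow>
     (\<forall>n. \<phi> n \<in> mor \<C> (G n) (G' n)) \<and>
     (\<forall>n. d' (Suc n) \<cdot>\<^bsub>\<C>\<^esub> \<phi> (Suc n) = \<phi> n \<cdot>\<^bsub>\<C>\<^esub> d (Suc n))"

end

theory Submission
  imports Defs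
begin

text \<open>
  The resolution of \<open>B\<close> is built row by row. Since \<open>A \<rightarrow> B \<rightarrow> C\<close> is \<open>\<C>(GP, -)\<close>-exact, the map
  \<open>f\<^sub>C : G\<^sub>C \<rightarrow> C\<close> lifts to \<open>h : G\<^sub>C \<rightarrow> B\<close>, and this lift makes the weak pullback of \<open>y\<close> and \<open>f\<^sub>C\<close> a
  biproduct: \<open>[x, h] : A \<oplus> G\<^sub>C \<rightarrow> B\<close> is a deflation with fiber \<open>K\<^sub>C\<close>. It is composed with
  \<open>f\<^sub>A \<oplus> 1 : G\<^sub>A \<oplus> G\<^sub>C \<rightarrow> A \<oplus> G\<^sub>C\<close>, whose fiber is \<open>K\<^sub>A\<close>, and the dual of (ET4) yields triangles
  \<open>K\<^sub>B \<rightarrow> G\<^sub>A \<oplus> G\<^sub>C \<rightarrow> B\<close> and \<open>K\<^sub>A \<rightarrow> K\<^sub>B \<rightarrow> K\<^sub>C\<close>. The first lies in \<open>\<xi>\<close> by saturation, the second by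
  base change, and the second is the next row. The \<open>\<C>(GP, -)\<close>-exactness of both is a diagram chase,
  and \<open>G\<^sub>A \<oplus> G\<^sub>C\<close> is Gorenstein projective because complete resolutions can be added.
\<close>

section \<open>Additive categories\<close>

context additive_category
begin

text \<open>Bundles both object conditions with membership in the Hom-group, so that one typing fact
  discharges every side condition of the category axioms.\<close>

definition arr :: "'o \<Rightarrow> 'o \<Rightarrow> 'm \<Rightarrow> bool" where
  "arr A B f \<longleftrightarrow> A \<in> Ob \<C> \<and> B \<in> Ob \<C> \<and> f \<in> mor \<C> A B"

abbreviation nul :: "'o \<Rightarrow> 'o \<Rightarrow> 'm" where
  "nul A B \<equiv> \<one>\<^bsub>Hom \<C> A B\<^esub>"

abbreviation add :: "'o \<Rightarrow> 'o \<Rightarrow> 'm \<Rightarrow> 'm \<Rightarrow> 'm" where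
  "add A B f g \<equiv> f \<otimes>\<^bsub>Hom \<C> A B\<^esub> g"

abbreviation neg :: "'o \<Rightarrow> 'o \<Rightarrow> 'm \<Rightarrow> 'm" where
  "neg A B f \<equiv> inv\<^bsub>Hom \<C> A B\<^esub> f"

lemma arrD:
  assumes "arr A B f"
  shows "A \<in> Ob \<C>" "B \<in> Ob \<C>" "f \<in> mor \<C> A B"
  using assms by (auto simp: arr_def)

lemma arr_cmp [intro]: "arr A B f \<Longrightarrow> arr B C g \<Longrightarrow> arr A C (g \<cdot> f)"
  by (auto simp: arr_def cmp_mor)

lemma arr_idn [intro]: "A \<in> Ob \<C> \<Longrightarrow> arr A A (idn \<C> A)"
  by (auto simp: arr_def idn_mor)

lemma arr_nul [intro]:
  assumes "A \<in> Ob \<C>" "B \<in> Ob \<C>"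
  shows "arr A B (nul A B)"
proof -
  interpret comm_group "Hom \<C> A B" using assms by (rule hom_group)
  show ?thesis using assms by (simp add: arr_def)
qed

lemma arr_add [intro]:
  assumes "arr A B f" "arr A B g"
  shows "arr A B (add A B f g)"
proof -
  interpret comm_group "Hom \<C> A B" using assms arr_def hom_group by blast
  show ?thesis using assms by (simp add: arr_def)
qed

lemma arr_neg [intro]:
  assumes "arr A B f"
  shows "arr A B (neg A B f)"
proof -
  interpret comm_group "Hom \<C> A B" using assms arr_def hom_group by blast
  show ?thesis using assms by (simp add: arr_def)
qed

lemma cmp_idn_left: "arr A B f \<Longrightarrow> idn \<C> B \<cdot> f = f"
  by (auto simp: arr_def idn_left)

lemma cmp_idn_right: "arr A B f \<Longrightarrow> f \<cdot> idn \<C> A = f"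
  by (auto simp: arr_def idn_right)

lemma assoc: "arr A B f \<Longrightarrow> arr B C g \<Longrightarrow> arr C D h \<Longrightarrow> (h \<cdot> g) \<cdot> f = h \<cdot> (g \<cdot> f)"
  unfolding arr_def using cmp_assoc by blast

text \<open>Removes a cancelling pair from the middle of a fourfold composite. Composition of
  isomorphisms and transport of biproducts reduce to this.\<close>

lemma cmp_cancel:
  assumes "arr A B f" "arr B C s" "arr C B t" "arr B D g" "t \<cdot> s = idn \<C> B"
  shows "(g \<cdot> t) \<cdot> (s \<cdot> f) = g \<cdot> f"
  using assoc[OF arr_cmp[OF assms(1,2)] assms(3,4)] assoc[OF assms(1-3)] assms(5)
    cmp_idn_left[OF assms(1)] by simp

lemma cmp_add: "arr A B f \<Longrightarrow> arr A B f' \<Longrightarrow> arr B C g \<Longrightarrow> g \<cdot> add A B f f' = add A C (g \<cdot> f) (g \<cdot> f')"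
  by (auto simp: arr_def cmp_add_right)

lemma add_cmp: "arr A B f \<Longrightarrow> arr B C g \<Longrightarrow> arr B C g' \<Longrightarrow> add B C g g' \<cdot> f = add A C (g \<cdot> f) (g' \<cdot> f)"
  by (auto simp: arr_def cmp_add_left)

lemma add_nul_left: assumes "arr A B f" shows "add A B (nul A B) f = f"
proof -
  interpret comm_group "Hom \<C> A B" using assms arr_def hom_group by blast
  show ?thesis using assms by (simp add: arr_def)
qed

lemma add_nul_right: assumes "arr A B f" shows "add A B f (nul A B) = f"
proof -
  interpret comm_group "Hom \<C> A B" using assms arr_def hom_group by blast
  show ?thesis using assms by (simp add: arr_def)
qed

lemma add_neg:
  assumes "arr A B f"
  shows "add A B f (neg A B f) = nul A B" "add A B (neg A B f) f = nul A B"
proof -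
  interpret comm_group "Hom \<C> A B" using assms arr_def hom_group by blast
  show "add A B f (neg A B f) = nul A B" "add A B (neg A B f) f = nul A B"
    using assms by (simp_all add: arr_def)
qed

lemma add_comm: assumes "arr A B f" "arr A B g" shows "add A B f g = add A B g f"
proof -
  interpret comm_group "Hom \<C> A B" using assms arr_def hom_group by blast
  show ?thesis using assms by (simp add: arr_def m_comm)
qed

lemma add_assoc:
  assumes "arr A B f" "arr A B g" "arr A B h"
  shows "add A B (add A B f g) h = add A B f (add A B g h)"
proof -
  interpret comm_group "Hom \<C> A B" using assms arr_def hom_group by blast
  show ?thesis using assms by (simp add: arr_def m_assoc)
qed

lemma neg_neg: assumes "arr A B f" shows "neg A B (neg A B f) = f"
proof -
  interpret comm_group "Hom \<C> A B" using assms arr_def hom_group by blast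
  show ?thesis using assms by (simp add: arr_def)
qed

lemma neg_unique:
  assumes "arr A B f" "arr A B g" "add A B f g = nul A B"
  shows "f = neg A B g"
proof -
  interpret comm_group "Hom \<C> A B" using assms arr_def hom_group by blast
  show ?thesis using assms inv_equality[of f g] by (simp add: arr_def)
qed

lemma diff_eq_nul:
  assumes "arr A B f" "arr A B g" "add A B f (neg A B g) = nul A B"
  shows "f = g"
  using neg_unique[OF assms(1) arr_neg[OF assms(2)] assms(3)] neg_neg[OF assms(2)] by simp

text \<open>Bilinearity is read as a group homomorphism in each variable, so that preservation of
  zero morphisms and negatives is plain group theory.\<close>

lemma hom_cmp_left:
  assumes "arr B C g" "A \<in> Ob \<C>"
  shows "group_hom (Hom \<C> A B) (Hom \<C> A C) (\<lambda>f. g \<cdot> f)"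
proof -
  interpret X: comm_group "Hom \<C> A B" using assms arr_def hom_group by blast
  interpret Y: comm_group "Hom \<C> A C" using assms arr_def hom_group by blast
  show ?thesis
    by standard (use assms in \<open>auto simp: hom_def arr_def cmp_mor cmp_add_right\<close>)
qed

lemma hom_cmp_right:
  assumes "arr A B f" "C \<in> Ob \<C>"
  shows "group_hom (Hom \<C> B C) (Hom \<C> A C) (\<lambda>g. g \<cdot> f)"
proof -
  interpret X: comm_group "Hom \<C> B C" using assms arr_def hom_group by blast
  interpret Y: comm_group "Hom \<C> A C" using assms arr_def hom_group by blast
  show ?thesis
    by standard (use assms in \<open>auto simp: hom_def arr_def cmp_mor cmp_add_left\<close>)
qed

lemma cmp_nul: "arr B C g \<Longrightarrow> A \<in> Ob \<C> \<Longrightarrow> g \<cdot> nul A B = nul A C"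
  using group_hom.hom_one[OF hom_cmp_left] .

lemma nul_cmp: "arr A B f \<Longrightarrow> C \<in> Ob \<C> \<Longrightarrow> nul B C \<cdot> f = nul A C"
  using group_hom.hom_one[OF hom_cmp_right] .

lemma cmp_neg: "arr A B f \<Longrightarrow> arr B C g \<Longrightarrow> g \<cdot> neg A B f = neg A C (g \<cdot> f)"
  using group_hom.hom_inv[OF hom_cmp_left] unfolding arr_def by blast

lemma neg_cmp: "arr A B f \<Longrightarrow> arr B C g \<Longrightarrow> neg B C g \<cdot> f = neg A C (g \<cdot> f)"
  using group_hom.hom_inv[OF hom_cmp_right] unfolding arr_def by blast

section \<open>Zero objects and isomorphisms\<close>

lemma zero_objD:
  assumes "zero_obj \<C> Z"
  shows "Z \<in> Ob \<C>" "arr A Z f \<Longrightarrow> f = nul A Z" "arr Z A f \<Longrightarrow> f = nul Z A"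
  using assms unfolding zero_obj_def arr_def trivial_group_def by auto

lemma iso_morI:
  "arr A B f \<Longrightarrow> arr B A g \<Longrightarrow> g \<cdot> f = idn \<C> A \<Longrightarrow> f \<cdot> g = idn \<C> B \<Longrightarrow> iso_mor \<C> A B f"
  unfolding iso_mor_def arr_def by blast

lemma iso_morE:
  assumes "iso_mor \<C> A B f" "A \<in> Ob \<C>" "B \<in> Ob \<C>"
  obtains g where "arr A B f" "arr B A g" "g \<cdot> f = idn \<C> A" "f \<cdot> g = idn \<C> B"
  using assms unfolding iso_mor_def arr_def by blast

lemma iso_mor_cmp:
  assumes "iso_mor \<C> A B f" "iso_mor \<C> B C g" "A \<in> Ob \<C>" "B \<in> Ob \<C>" "C \<in> Ob \<C>"
  shows "iso_mor \<C> A C (g \<cdot> f)"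
proof -
  obtain f' where f: "arr A B f" "arr B A f'" "f' \<cdot> f = idn \<C> A" "f \<cdot> f' = idn \<C> B"
    using assms by (blast elim: iso_morE)
  obtain g' where g: "arr B C g" "arr C B g'" "g' \<cdot> g = idn \<C> B" "g \<cdot> g' = idn \<C> C"
    using assms by (blast elim: iso_morE)
  have "(f' \<cdot> g') \<cdot> (g \<cdot> f) = idn \<C> A"
    using cmp_cancel[OF f(1) g(1,2) f(2) g(3)] f(3) by simp
  moreover have "(g \<cdot> f) \<cdot> (f' \<cdot> g') = idn \<C> C"
    using cmp_cancel[OF g(2) f(2,1) g(1) f(4)] g(4) by simp
  ultimately show ?thesis using iso_morI[OF arr_cmp[OF f(1) g(1)] arr_cmp[OF g(2) f(2)]] by blast
qed

subsection \<open>Biproducts\<close>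

lemma biproductD:
  assumes "biproduct \<C> A B P i p j q" "A \<in> Ob \<C>" "B \<in> Ob \<C>"
  shows "P \<in> Ob \<C>" "arr A P i" "arr P A p" "arr B P j" "arr P B q"
    "p \<cdot> i = idn \<C> A" "q \<cdot> j = idn \<C> B" "p \<cdot> j = nul B A" "q \<cdot> i = nul A B"
    "add P P (i \<cdot> p) (j \<cdot> q) = idn \<C> P"
  using assms unfolding biproduct_def arr_def by auto

lemma biproductI:
  assumes "arr A P i" "arr P A p" "arr B P j" "arr P B q"
    "p \<cdot> i = idn \<C> A" "q \<cdot> j = idn \<C> B" "p \<cdot> j = nul B A" "q \<cdot> i = nul A B"
    "add P P (i \<cdot> p) (j \<cdot> q) = idn \<C> P"
  shows "biproduct \<C> A B P i p j q"
  using assms unfolding biproduct_def arr_def by auto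

lemma biproduct_swap:
  assumes "biproduct \<C> A B P i p j q" "A \<in> Ob \<C>" "B \<in> Ob \<C>"
  shows "biproduct \<C> B A P j q i p"
  using biproductD[OF assms] by (intro biproductI) (auto simp: add_comm[of P P "j \<cdot> q"] arr_cmp)

text \<open>Two signs cancel in both composites of \<open>i\<close> and \<open>p\<close>, and the
  cross terms stay zero. This later absorbs the sign with which \<open>x\<close> enters the weak
  pullback.\<close>

lemma biproduct_neg:
  assumes "biproduct \<C> A B P i p j q" "A \<in> Ob \<C>" "B \<in> Ob \<C>"
  shows "biproduct \<C> A B P (neg A P i) (neg P A p) j q"
proof -
  note D = biproductD[OF assms]
  have 1: "neg P A p \<cdot> neg A P i = p \<cdot> i" "neg A P i \<cdot> neg P A p = i \<cdot> p"
    using cmp_neg[OF D(2) arr_neg[OF D(3)]] neg_cmp[OF D(2,3)] neg_neg[OF arr_cmp[OF D(2,3)]]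
      cmp_neg[OF D(3) arr_neg[OF D(2)]] neg_cmp[OF D(3,2)] neg_neg[OF arr_cmp[OF D(3,2)]] by simp_all
  show ?thesis
  proof (rule biproductI)
    show "neg P A p \<cdot> j = nul B A"
      using neg_cmp[OF D(4,3)] D(8) neg_unique[of B A "nul B A" "nul B A"] assms(2,3)
      by (metis add_nul_left arr_nul)
    show "q \<cdot> neg A P i = nul A B"
      using cmp_neg[OF D(2,5)] D(9) neg_unique[of A B "nul A B" "nul A B"] assms(2,3)
      by (metis add_nul_left arr_nul)
  qed (use D 1 in auto)
qed

lemma biproduct_iso:
  assumes "biproduct \<C> A B P i p j q" "A \<in> Ob \<C>" "B \<in> Ob \<C>"
    "arr P Q t" "arr Q P s" "s \<cdot> t = idn \<C> P" "t \<cdot> s = idn \<C> Q"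
  shows "biproduct \<C> A B Q (t \<cdot> i) (p \<cdot> s) (t \<cdot> j) (q \<cdot> s)"
proof -
  note D = biproductD[OF assms(1-3)]
  have c: "(u \<cdot> s) \<cdot> (t \<cdot> v) = u \<cdot> v" if "arr P Y u" "arr X P v" for X Y u v
    using cmp_cancel[OF that(2) assms(4,5) that(1) assms(6)] .
  show ?thesis
  proof (rule biproductI)
    have *: "(t \<cdot> v) \<cdot> (u \<cdot> s) = t \<cdot> ((v \<cdot> u) \<cdot> s)" if "arr P Y u" "arr Y P v" for Y u v
      using assoc[OF arr_cmp[OF assms(5) that(1)] that(2) assms(4)] assoc[OF assms(5) that] by simp
    have "add Q Q ((t \<cdot> i) \<cdot> p \<cdot> s) ((t \<cdot> j) \<cdot> q \<cdot> s) = t \<cdot> (add P P (i \<cdot> p) (j \<cdot> q) \<cdot> s)"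
      using D(2-5) assms(4,5) by (simp add: * cmp_add add_cmp arr_cmp)
    then show "add Q Q ((t \<cdot> i) \<cdot> p \<cdot> s) ((t \<cdot> j) \<cdot> q \<cdot> s) = idn \<C> Q"
      using D(10) cmp_idn_left[OF assms(5)] assms(7) by simp
  qed (use D c assms in \<open>auto\<close>)
qed

text \<open>As \<open>i \<cdot> p\<close> and \<open>j \<cdot> q\<close> add up to the identity, a
  morphism out of \<open>P\<close> is rebuilt from its restrictions along \<open>i\<close> and
  \<open>j\<close>.\<close>

lemma biproduct_ext_from:
  assumes "biproduct \<C> A B P i p j q" "A \<in> Ob \<C>" "B \<in> Ob \<C>"
    "arr P X u" "arr P X v" "u \<cdot> i = v \<cdot> i" "u \<cdot> j = v \<cdot> j"
  shows "u = v"
proof -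
  note D = biproductD[OF assms(1-3)]
  have "w = add P X ((w \<cdot> i) \<cdot> p) ((w \<cdot> j) \<cdot> q)" if "arr P X w" for w
    using cmp_add[OF arr_cmp[OF D(3,2)] arr_cmp[OF D(5,4)] that] assoc[OF D(3,2) that]
      assoc[OF D(5,4) that] D(10) cmp_idn_right[OF that] by simp
  from this[OF assms(4)] this[OF assms(5)] show ?thesis using assms(6,7) by simp
qed

lemma biproduct_ext_to:
  assumes "biproduct \<C> A B P i p j q" "A \<in> Ob \<C>" "B \<in> Ob \<C>"
    "arr X P u" "arr X P v" "p \<cdot> u = p \<cdot> v" "q \<cdot> u = q \<cdot> v"
  shows "u = v"
proof -
  note D = biproductD[OF assms(1-3)]
  have "w = add X P (i \<cdot> (p \<cdot> w)) (j \<cdot> (q \<cdot> w))" if "arr X P w" for w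
    using add_cmp[OF that arr_cmp[OF D(3,2)] arr_cmp[OF D(5,4)]] assoc[OF that D(3,2)]
      assoc[OF that D(5,4)] D(10) cmp_idn_left[OF that] by simp
  from this[OF assms(4)] this[OF assms(5)] show ?thesis using assms(6,7) by simp
qed

lemma biproduct_copair:
  assumes "biproduct \<C> A B P i p j q" "A \<in> Ob \<C>" "B \<in> Ob \<C>" "arr A X f" "arr B X g"
  obtains u where "arr P X u" "u \<cdot> i = f" "u \<cdot> j = g"
proof
  note D = biproductD[OF assms(1-3)]
  let ?u = "add P X (f \<cdot> p) (g \<cdot> q)"
  show "arr P X ?u" using D assms by blast
  have X: "X \<in> Ob \<C>" using assms arrD by blast
  show "?u \<cdot> i = f"
    using D assms(4,5) assms(2,3) X
    by (simp add: add_cmp[OF D(2)] arr_cmp assoc[OF D(2)] cmp_idn_right cmp_nul add_nul_right)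
  show "?u \<cdot> j = g"
    using D assms(4,5) assms(2,3) X
    by (simp add: add_cmp[OF D(4)] arr_cmp assoc[OF D(4)] cmp_idn_right cmp_nul add_nul_left)
qed

lemma biproduct_pair:
  assumes "biproduct \<C> A B P i p j q" "A \<in> Ob \<C>" "B \<in> Ob \<C>" "arr X A f" "arr X B g"
  obtains u where "arr X P u" "p \<cdot> u = f" "q \<cdot> u = g"
proof
  note D = biproductD[OF assms(1-3)]
  let ?u = "add X P (i \<cdot> f) (j \<cdot> g)"
  show "arr X P ?u" using D assms by blast
  have X: "X \<in> Ob \<C>" using assms arrD by blast
  show "p \<cdot> ?u = f"
    using D assms(4,5) assms(2,3) X
    by (simp add: cmp_add[OF _ _ D(3)] arr_cmp assoc[OF _ _ D(3), symmetric] cmp_idn_left nul_cmp add_nul_right)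
  show "q \<cdot> ?u = g"
    using D assms(4,5) assms(2,3) X
    by (simp add: cmp_add[OF _ _ D(5)] arr_cmp assoc[OF _ _ D(5), symmetric] cmp_idn_left nul_cmp add_nul_left)
qed

lemma biproduct_family:
  assumes "\<And>n. A n \<in> Ob \<C>" "\<And>n. B n \<in> Ob \<C>"
  obtains P i p j q where "\<And>n. biproduct \<C> (A n) (B n) (P n) (i n) (p n) (j n) (q n)"
proof -
  have "\<forall>n. \<exists>P i p j q. biproduct \<C> (A n) (B n) P i p j q" using biproduct_exists assms by blast
  then show ?thesis using that by metis
qed

lemma biproduct_unique:
  assumes "biproduct \<C> A B P i p j q" "biproduct \<C> A B P' i' p' j' q'" "A \<in> Ob \<C>" "B \<in> Ob \<C>"
  shows "isomorphic \<C> P P'"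
proof -
  note D = biproductD[OF assms(1,3,4)] and D' = biproductD[OF assms(2,3,4)]
  obtain u where u: "arr P P' u" "u \<cdot> i = i'" "u \<cdot> j = j'"
    using biproduct_copair[OF assms(1,3,4) D'(2,4)] .
  obtain v where v: "arr P' P v" "v \<cdot> i' = i" "v \<cdot> j' = j"
    using biproduct_copair[OF assms(2,3,4) D(2,4)] .
  have "v \<cdot> u = idn \<C> P"
    by (rule biproduct_ext_from[OF assms(1,3,4)])
      (use u v D in \<open>auto simp: assoc[OF D(2)] assoc[OF D(4)] cmp_idn_left\<close>)
  moreover have "u \<cdot> v = idn \<C> P'"
    by (rule biproduct_ext_from[OF assms(2,3,4)])
      (use u v D' in \<open>auto simp: assoc[OF D'(2)] assoc[OF D'(4)] cmp_idn_left\<close>)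
  ultimately show ?thesis unfolding isomorphic_def using u v iso_morI by blast
qed

text \<open>Realizing the zero extension on this biproduct gives the split triangle
  \<open>A -> A -> 0\<close>, the test object from which exactness of triangles is derived.\<close>

lemma biproduct_zero_right:
  assumes "zero_obj \<C> Z" "A \<in> Ob \<C>"
  shows "biproduct \<C> A Z A (idn \<C> A) (idn \<C> A) (nul Z A) (nul A Z)"
proof (rule biproductI)
  note Z = zero_objD[OF assms(1)]
  note arrs = arr_idn[OF assms(2)] arr_nul[OF assms(2) Z(1)] arr_nul[OF Z(1) assms(2)]
  show "arr A A (idn \<C> A)" "arr A A (idn \<C> A)" "arr Z A (nul Z A)" "arr A Z (nul A Z)"
    by (fact arrs)+
  show "idn \<C> A \<cdot> idn \<C> A = idn \<C> A" "idn \<C> A \<cdot> nul Z A = nul Z A" "nul A Z \<cdot> idn \<C> A = nul A Z"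
    using arrs cmp_idn_left cmp_idn_right by blast+
  show "nul A Z \<cdot> nul Z A = idn \<C> Z"
    using Z(2)[OF arr_cmp[OF arrs(3,2)]] Z(2)[OF arr_idn[OF Z(1)]] by simp
  show "add A A (idn \<C> A \<cdot> idn \<C> A) (nul Z A \<cdot> nul A Z) = idn \<C> A"
    by (simp add: cmp_idn_left[OF arrs(1)] nul_cmp[OF arrs(2) assms(2)] add_nul_right[OF arrs(1)])
qed

lemma biproduct_zero_left:
  assumes "zero_obj \<C> Z" "A \<in> Ob \<C>"
  shows "biproduct \<C> Z A A (nul Z A) (nul A Z) (idn \<C> A) (idn \<C> A)"
  using biproduct_swap[OF biproduct_zero_right[OF assms]] assms zero_objD(1) by blast

text \<open>The description of \<open>sum_mor\<close> as a diagonal matrix: an injection of one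
  summand followed by the projection to the other is zero, so only one of the two terms survives in
  each equation.\<close>

lemma sum_morD:
  assumes "biproduct \<C> A A' S i p j q" "A \<in> Ob \<C>" "A' \<in> Ob \<C>"
    and "biproduct \<C> B B' T k r l s" "B \<in> Ob \<C>" "B' \<in> Ob \<C>"
    and "arr A B u" "arr A' B' u'"
  defines "w \<equiv> sum_mor \<C> S p q T k l u u'"
  shows "arr S T w" "w \<cdot> i = k \<cdot> u" "w \<cdot> j = l \<cdot> u'" "r \<cdot> w = u \<cdot> p" "s \<cdot> w = u' \<cdot> q"
proof -
  note D = biproductD[OF assms(1-3)] and D' = biproductD[OF assms(4-6)]
  have a: "arr S T (k \<cdot> u \<cdot> p)" "arr S T (l \<cdot> u' \<cdot> q)" using D D' assms by blast+
  show w: "arr S T w" unfolding w_def sum_mor_def using a by blast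
  have [simp]: "add A T (k \<cdot> u) (nul A T) = k \<cdot> u" "add A' T (nul A' T) (l \<cdot> u') = l \<cdot> u'"
    "add S B (u \<cdot> p) (nul S B) = u \<cdot> p" "add S B' (nul S B') (u' \<cdot> q) = u' \<cdot> q"
    using D D' assms by (auto simp: add_nul_left add_nul_right arr_cmp)
  have from_i: "(k \<cdot> u \<cdot> p) \<cdot> v = k \<cdot> u \<cdot> (p \<cdot> v)" "(l \<cdot> u' \<cdot> q) \<cdot> v = l \<cdot> u' \<cdot> (q \<cdot> v)"
    if "arr X S v" for X v
    using assoc[OF that arr_cmp[OF D(3) assms(7)] D'(2)] assoc[OF that D(3) assms(7)]
      assoc[OF that arr_cmp[OF D(5) assms(8)] D'(4)] assoc[OF that D(5) assms(8)] by simp_all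
  have to_r: "v \<cdot> k \<cdot> u \<cdot> p = (v \<cdot> k) \<cdot> u \<cdot> p" "v \<cdot> l \<cdot> u' \<cdot> q = (v \<cdot> l) \<cdot> u' \<cdot> q"
    if "arr T X v" for X v
    using assoc[OF arr_cmp[OF D(3) assms(7)] D'(2) that] assoc[OF arr_cmp[OF D(5) assms(8)] D'(4) that]
    by simp_all
  note [simp] = D(6-9) D'(6-9) cmp_idn_right[OF assms(7)] cmp_idn_right[OF assms(8)]
    cmp_idn_left[OF arr_cmp[OF D(3) assms(7)]] cmp_idn_left[OF arr_cmp[OF D(5) assms(8)]]
    cmp_nul[OF assms(7)] cmp_nul[OF assms(8)] cmp_nul[OF D'(2)] cmp_nul[OF D'(4)] assms(2,3,5,6)
    nul_cmp[OF arr_cmp[OF D(3) assms(7)]] nul_cmp[OF arr_cmp[OF D(5) assms(8)]]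
  show "w \<cdot> i = k \<cdot> u"
    unfolding w_def sum_mor_def add_cmp[OF D(2) a] by (simp add: from_i[OF D(2)])
  show "w \<cdot> j = l \<cdot> u'"
    unfolding w_def sum_mor_def add_cmp[OF D(4) a] by (simp add: from_i[OF D(4)])
  show "r \<cdot> w = u \<cdot> p"
    unfolding w_def sum_mor_def cmp_add[OF a D'(3)] by (simp add: to_r[OF D'(3)])
  show "s \<cdot> w = u' \<cdot> q"
    unfolding w_def sum_mor_def cmp_add[OF a D'(5)] by (simp add: to_r[OF D'(5)])
qed

end

section \<open>Extriangulated categories\<close>

context extriangulated_category
begin

section \<open>Realizations and E-triangles\<close>

lemma Real_representative:
  assumes "A \<in> Ob \<C>" "C \<in> Ob \<C>" "\<delta> \<in> ext \<C> C A"
  obtains t where "t \<in> seqs \<C> A C" "Real \<C> C A \<delta> = seq_equiv \<C> A C `` {t}"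
  using Real_class[OF assms] by (auto elim: quotientE)

lemma seq_equiv_refl:
  assumes "A \<in> Ob \<C>" "C \<in> Ob \<C>" "t \<in> seqs \<C> A C"
  shows "(t, t) \<in> seq_equiv \<C> A C"
proof -
  obtain x B y where t: "t = (x, B, y)" by (metis prod_cases3)
  have o: "arr A B x" "arr B C y" using assms unfolding t seqs_def by (auto simp: arr_def)
  have "iso_mor \<C> B B (idn \<C> B)"
    using arr_idn[OF arrD(2)[OF o(1)]] cmp_idn_left iso_morI by blast
  moreover have "idn \<C> B \<cdot> x = x" "y \<cdot> idn \<C> B = y"
    using cmp_idn_left[OF o(1)] cmp_idn_right[OF o(2)] by auto
  ultimately show ?thesis using assms unfolding t seq_equiv_def by blast
qed

lemma realization_exists:
  assumes "A \<in> Ob \<C>" "C \<in> Ob \<C>" "\<delta> \<in> ext \<C> C A"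
  obtains x B y where "(A, x, B, y, C, \<delta>) \<in> etriangles \<C>"
proof -
  obtain t where t: "t \<in> seqs \<C> A C" "Real \<C> C A \<delta> = seq_equiv \<C> A C `` {t}"
    using Real_representative[OF assms] .
  obtain x B y where xy: "t = (x, B, y)" by (metis prod_cases3)
  have "t \<in> Real \<C> C A \<delta>" using t seq_equiv_refl[OF assms(1,2)] by auto
  moreover have "B \<in> Ob \<C>" using t xy by (simp add: seqs_def)
  ultimately show ?thesis using that assms xy unfolding etriangles_def by blast
qed

text \<open>The typing of \<open>x\<close> and \<open>y\<close> is not part of
  \<open>etriangles\<close>; it holds because a realization is an equivalence class of sequences
  from \<open>A\<close> to \<open>C\<close>.\<close>

lemma etriangleD:
  assumes "(A, x, B, y, C, \<delta>) \<in> etriangles \<C>"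
  shows "A \<in> Ob \<C>" "B \<in> Ob \<C>" "C \<in> Ob \<C>" "\<delta> \<in> ext \<C> C A" "arr A B x" "arr B C y"
    "(x, B, y) \<in> Real \<C> C A \<delta>"
proof -
  show o: "A \<in> Ob \<C>" "B \<in> Ob \<C>" "C \<in> Ob \<C>" "\<delta> \<in> ext \<C> C A" "(x, B, y) \<in> Real \<C> C A \<delta>"
    using assms by (auto simp: etriangles_def)
  obtain t where "Real \<C> C A \<delta> = seq_equiv \<C> A C `` {t}"
    using Real_representative[OF o(1,3,4)] .
  then have "(x, B, y) \<in> seqs \<C> A C" using o(5) unfolding seq_equiv_def by auto
  then show "arr A B x" "arr B C y" using o by (auto simp: seqs_def arr_def)
qed

text \<open>A realization is a full class modulo isomorphisms of the middle term. Composing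
  \<open>b\<close> with the isomorphism from a representative to \<open>B\<close> shows that the new
  sequence lies in the same class.\<close>

lemma etriangle_iso_middle:
  assumes "(A, x, B, y, C, \<delta>) \<in> etriangles \<C>" "arr B B' b" "iso_mor \<C> B B' b"
    and "arr B' C y'" "y' \<cdot> b = y"
  shows "(A, b \<cdot> x, B', y', C, \<delta>) \<in> etriangles \<C>"
proof -
  note D = etriangleD[OF assms(1)]
  obtain t where t: "t \<in> seqs \<C> A C" "Real \<C> C A \<delta> = seq_equiv \<C> A C `` {t}"
    using Real_representative[OF D(1,3,4)] .
  obtain x0 B0 y0 where xy: "t = (x0, B0, y0)" by (metis prod_cases3)
  have o: "arr A B0 x0" "arr B0 C y0" "B0 \<in> Ob \<C>"
    using D t unfolding xy seqs_def by (auto simp: arr_def)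
  obtain c where c: "iso_mor \<C> B0 B c" "c \<cdot> x0 = x" "y \<cdot> c = y0"
    using D(7) t xy unfolding seq_equiv_def by auto
  have "arr B0 B c" using c(1) o D unfolding iso_mor_def arr_def by blast
  then have "(b \<cdot> c) \<cdot> x0 = b \<cdot> x" "y' \<cdot> (b \<cdot> c) = y0"
    using assoc[OF o(1) _ assms(2)] assoc[OF _ assms(2,4)] c assms(5) by auto
  moreover have "iso_mor \<C> B0 B' (b \<cdot> c)"
    using iso_mor_cmp[OF c(1) assms(3) o(3) D(2) arrD(2)[OF assms(2)]] .
  moreover have "(b \<cdot> x, B', y') \<in> seqs \<C> A C"
    using arr_cmp[OF D(5) assms(2)] assms(4) by (auto simp: seqs_def arr_def)
  ultimately have "(b \<cdot> x, B', y') \<in> Real \<C> C A \<delta>"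
    using t xy unfolding seq_equiv_def by auto
  then show ?thesis using D arrD(2)[OF assms(2)] by (simp add: etriangles_def)
qed

subsection \<open>The bifunctor of extensions\<close>

lemma Emap_closed:
  assumes "arr A A' a" "arr C' C c" "\<delta> \<in> ext \<C> C A"
  shows "Emap \<C> c a \<delta> \<in> ext \<C> C' A'"
proof -
  have "Emap \<C> c a \<in> hom (Ext \<C> C A) (Ext \<C> C' A')"
    using assms unfolding arr_def by (intro Emap_hom) auto
  then show ?thesis using assms by (auto simp: hom_def)
qed

lemma Emap_one:
  assumes "arr A A' a" "arr C' C c"
  shows "Emap \<C> c a \<one>\<^bsub>Ext \<C> C A\<^esub> = \<one>\<^bsub>Ext \<C> C' A'\<^esub>"
proof -
  interpret X: comm_group "Ext \<C> C A" using assms unfolding arr_def by (intro ext_group) auto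
  interpret Y: comm_group "Ext \<C> C' A'" using assms unfolding arr_def by (intro ext_group) auto
  have "Emap \<C> c a \<in> hom (Ext \<C> C A) (Ext \<C> C' A')"
    using assms unfolding arr_def by (intro Emap_hom) auto
  then show ?thesis using X.is_group Y.is_group by (rule hom_one)
qed

lemma Emap_assoc:
  assumes "arr A A' a" "arr A' A'' a'" "arr C' C c" "arr C'' C' c'" "\<delta> \<in> ext \<C> C A"
  shows "Emap \<C> (c \<cdot> c') (a' \<cdot> a) \<delta> = Emap \<C> c' a' (Emap \<C> c a \<delta>)"
  using assms Emap_cmp[of A A' A'' C C' C'' a a' c c' \<delta>] unfolding arr_def by blast

lemma push_closed: "arr A A' a \<Longrightarrow> C \<in> Ob \<C> \<Longrightarrow> \<delta> \<in> ext \<C> C A \<Longrightarrow> push \<C> C a \<delta> \<in> ext \<C> C A'"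
  unfolding push_def by (rule Emap_closed) auto

lemma pull_closed: "arr C' C c \<Longrightarrow> A \<in> Ob \<C> \<Longrightarrow> \<delta> \<in> ext \<C> C A \<Longrightarrow> pull \<C> c A \<delta> \<in> ext \<C> C' A"
  unfolding pull_def by (rule Emap_closed) auto

lemma pull_one: "arr C' C c \<Longrightarrow> A \<in> Ob \<C> \<Longrightarrow> pull \<C> c A \<one>\<^bsub>Ext \<C> C A\<^esub> = \<one>\<^bsub>Ext \<C> C' A\<^esub>"
  unfolding pull_def by (rule Emap_one) auto

lemma push_cmp:
  assumes "arr A A' a" "arr A' A'' a'" "C \<in> Ob \<C>" "\<delta> \<in> ext \<C> C A"
  shows "push \<C> C (a' \<cdot> a) \<delta> = push \<C> C a' (push \<C> C a \<delta>)"
  using Emap_assoc[OF assms(1,2) arr_idn arr_idn assms(4)] assms(3)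
    cmp_idn_left[OF arr_idn[OF assms(3)]]
  by (simp add: push_def)

lemma pull_cmp:
  assumes "arr C' C c" "arr C'' C' c'" "A \<in> Ob \<C>" "\<delta> \<in> ext \<C> C A"
  shows "pull \<C> (c \<cdot> c') A \<delta> = pull \<C> c' A (pull \<C> c A \<delta>)"
  using Emap_assoc[OF arr_idn arr_idn assms(1,2,4)] assms(3) cmp_idn_left[OF arr_idn[OF assms(3)]]
  by (simp add: pull_def)

lemma push_idn: "A \<in> Ob \<C> \<Longrightarrow> C \<in> Ob \<C> \<Longrightarrow> \<delta> \<in> ext \<C> C A \<Longrightarrow> push \<C> C (idn \<C> A) \<delta> = \<delta>"
  by (simp add: push_def Emap_idn)

lemma pull_idn: "A \<in> Ob \<C> \<Longrightarrow> C \<in> Ob \<C> \<Longrightarrow> \<delta> \<in> ext \<C> C A \<Longrightarrow> pull \<C> (idn \<C> C) A \<delta> = \<delta>"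
  by (simp add: pull_def Emap_idn)

lemma push_add:
  assumes "arr A A' a" "arr A A' a'" "C \<in> Ob \<C>" "\<delta> \<in> ext \<C> C A"
  shows "push \<C> C (add A A' a a') \<delta> = push \<C> C a \<delta> \<otimes>\<^bsub>Ext \<C> C A'\<^esub> push \<C> C a' \<delta>"
  using assms idn_mor unfolding push_def arr_def by (intro Emap_add_cov) auto

lemma push_neg:
  assumes "arr A A' a" "C \<in> Ob \<C>" "\<delta> \<in> ext \<C> C A"
  shows "push \<C> C (neg A A' a) \<delta> = inv\<^bsub>Ext \<C> C A'\<^esub> push \<C> C a \<delta>"
proof -
  have A: "A \<in> Ob \<C>" "A' \<in> Ob \<C>" using assms arrD by blast+
  interpret comm_group "Ext \<C> C A'" using assms A by (intro ext_group)
  have z: "arr A A' (nul A A')" using A by blast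
  have cl: "push \<C> C b \<delta> \<in> ext \<C> C A'" if "arr A A' b" for b
    using push_closed[OF that assms(2,3)] .
  \<comment> \<open>Pushing along 0 + 0 = 0 gives an idempotent of the extension group, hence its
    neutral element.\<close>
  have "push \<C> C (nul A A') \<delta> = \<one>\<^bsub>Ext \<C> C A'\<^esub>"
    using push_add[OF z z assms(2,3)] add_nul_left[OF z] cl[OF z] by simp
  then show ?thesis
    using push_add[OF arr_neg[OF assms(1)] assms(1,2,3)] add_neg(2)[OF assms(1)]
      cl[OF assms(1)] cl[OF arr_neg[OF assms(1)]] inv_equality by simp
qed

lemma etriangle_biproduct:
  assumes "biproduct \<C> A C P i p j q" "A \<in> Ob \<C>" "C \<in> Ob \<C>"
  shows "(A, i, P, q, C, \<one>\<^bsub>Ext \<C> C A\<^esub>) \<in> etriangles \<C>"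
proof -
  interpret comm_group "Ext \<C> C A" using assms by (intro ext_group)
  show ?thesis using ET2_zero[OF assms(2,3,1)] assms biproductD(1)[OF assms]
    by (simp add: etriangles_def)
qed

subsection \<open>Exactness of triangles\<close>

text \<open>By (ET3), the pair of the identity and \<open>x\<close> maps the split triangle
  \<open>A -> A -> 0\<close> to the given one; the third component factors
  \<open>y \<cdot> x\<close> through a zero object.\<close>

lemma etriangle_cmp:
  assumes "(A, x, B, y, C, \<delta>) \<in> etriangles \<C>"
  shows "y \<cdot> x = nul A C"
proof -
  note D = etriangleD[OF assms]
  obtain Z where Z: "zero_obj \<C> Z" using zero_exists by blast
  note ZO = zero_objD(1)[OF Z]
  have t: "(A, idn \<C> A, A, nul A Z, Z, \<one>\<^bsub>Ext \<C> Z A\<^esub>) \<in> etriangles \<C>"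
    using etriangle_biproduct[OF biproduct_zero_right[OF Z D(1)] D(1) ZO] .
  obtain c where c: "c \<cdot> nul A Z = y \<cdot> x" "ext_morphism \<C> Z A \<one>\<^bsub>Ext \<C> Z A\<^esub> C A \<delta> (idn \<C> A) c"
    using ET3[OF t assms idn_mor[OF D(1)] arrD(3)[OF D(5)]] by blast
  have "arr Z C c" using c(2) D ZO unfolding ext_morphism_def arr_def by blast
  then show ?thesis using c(1) cmp_nul[OF _ D(1)] by simp
qed

text \<open>The condition on \<open>w\<close> is a commutative right square from the split triangle
  \<open>W -> W -> 0\<close>, with zero as its third component; the dual of (ET3) supplies the
  factorization.\<close>

lemma etriangle_exact:
  assumes "(A, x, B, y, C, \<delta>) \<in> etriangles \<C>" "arr W B w" "y \<cdot> w = nul W C"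
  obtains v where "arr W A v" "x \<cdot> v = w"
proof -
  note D = etriangleD[OF assms(1)]
  have W: "W \<in> Ob \<C>" using assms(2) arrD by blast
  obtain Z where Z: "zero_obj \<C> Z" using zero_exists by blast
  note ZO = zero_objD(1)[OF Z]
  have t: "(W, idn \<C> W, W, nul W Z, Z, \<one>\<^bsub>Ext \<C> Z W\<^esub>) \<in> etriangles \<C>"
    using etriangle_biproduct[OF biproduct_zero_right[OF Z W] W ZO] .
  have "nul Z C \<cdot> nul W Z = y \<cdot> w"
    using assms(3) nul_cmp[OF arr_nul[OF W ZO] D(3)] by simp
  then obtain a where a: "w \<cdot> idn \<C> W = x \<cdot> a"
      "ext_morphism \<C> Z W \<one>\<^bsub>Ext \<C> Z W\<^esub> C A \<delta> a (nul Z C)"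
    using ET3_op[OF t assms(1) arrD(3)[OF assms(2)] arrD(3)[OF arr_nul[OF ZO D(3)]]] by blast
  have "arr W A a" using a(2) D W unfolding ext_morphism_def arr_def by blast
  then show ?thesis using that a(1) cmp_idn_right[OF assms(2)] by simp
qed

text \<open>When \<open>a\<close> kills the extension, \<open>a\<close> together with zero is a
  morphism to the extension realized by \<open>X -> X -> 0\<close>. The middle map provided by (ET2)
  is the required extension of \<open>a\<close>.\<close>

lemma etriangle_extend:
  assumes "(A, x, B, y, C, \<delta>) \<in> etriangles \<C>" "arr A X a" "push \<C> C a \<delta> = \<one>\<^bsub>Ext \<C> C X\<^esub>"
  obtains t where "arr B X t" "t \<cdot> x = a"
proof -
  note D = etriangleD[OF assms(1)]
  have X: "X \<in> Ob \<C>" using assms(2) arrD by blast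
  obtain Z where Z: "zero_obj \<C> Z" using zero_exists by blast
  note ZO = zero_objD(1)[OF Z]
  have t: "(X, idn \<C> X, X, nul X Z, Z, \<one>\<^bsub>Ext \<C> Z X\<^esub>) \<in> etriangles \<C>"
    using etriangle_biproduct[OF biproduct_zero_right[OF Z X] X ZO] .
  have "ext_morphism \<C> C A \<delta> Z X \<one>\<^bsub>Ext \<C> Z X\<^esub> a (nul C Z)"
    unfolding ext_morphism_def
    using assms(2,3) pull_one[OF arr_nul[OF D(3) ZO] X] arrD(3)[OF arr_nul[OF D(3) ZO]] arrD(3)[OF assms(2)]
    by simp
  from ET2_realize[OF assms(1) t this] obtain b
    where b: "b \<in> mor \<C> B X" "b \<cdot> x = idn \<C> X \<cdot> a" by blast
  then show ?thesis using that[of b] D X cmp_idn_left[OF assms(2)] by (simp add: arr_def)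
qed

text \<open>\<open>n = 1 - a\<close> extends along \<open>x\<close> and is killed by \<open>x\<close>, so \<open>n\<^sup>2 = 0\<close> and \<open>1 + n\<close> inverts \<open>a\<close>.\<close>

lemma endomorphism_inverse:
  assumes "(A, x, B, y, C, \<delta>) \<in> etriangles \<C>" "arr A A a"
    and "x \<cdot> a = x" "push \<C> C a \<delta> = \<delta>"
  obtains b where "arr A A b" "b \<cdot> a = idn \<C> A" "a \<cdot> b = idn \<C> A"
proof -
  note D = etriangleD[OF assms(1)]
  note i = arr_idn[OF D(1)] and na = arr_neg[OF assms(2)]
  let ?n = "add A A (idn \<C> A) (neg A A a)"
  have n: "arr A A ?n" using i na by blast
  interpret E: comm_group "Ext \<C> C A" using D by (intro ext_group)
  have "push \<C> C ?n \<delta> = \<one>\<^bsub>Ext \<C> C A\<^esub>"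
    using push_add[OF i na D(3,4)] push_idn[OF D(1,3,4)] push_neg[OF assms(2) D(3,4)] assms(4) D(4)
    by simp
  then obtain t where t: "arr B A t" "t \<cdot> x = ?n" using etriangle_extend[OF assms(1) n] by blast
  have "x \<cdot> ?n = nul A B"
    using cmp_add[OF i na D(5)] cmp_idn_right[OF D(5)] cmp_neg[OF assms(2) D(5)] assms(3)
      add_neg[OF D(5)] by simp
  then have nn: "?n \<cdot> ?n = nul A A"
    using assoc[OF n D(5) t(1)] t(2) cmp_nul[OF t(1) D(1)] by simp
  have a: "add A A ?n a = idn \<C> A"
    using add_assoc[OF i na assms(2)] add_neg(2)[OF assms(2)] add_nul_right[OF i] by simp
  \<comment> \<open>Multiply the relation n + a = 1 by n on either side and use that n squares to
    zero.\<close>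
  have "?n \<cdot> a = ?n" "a \<cdot> ?n = ?n"
  proof -
    have "?n \<cdot> add A A ?n a = ?n" "add A A ?n a \<cdot> ?n = ?n"
      using a cmp_idn_right[OF n] cmp_idn_left[OF n] by simp_all
    then show "?n \<cdot> a = ?n" "a \<cdot> ?n = ?n"
      using cmp_add[OF n assms(2) n] add_cmp[OF n n assms(2)] nn
        add_nul_left[OF arr_cmp[OF assms(2) n]] add_nul_left[OF arr_cmp[OF n assms(2)]] by simp_all
  qed
  then have "add A A (idn \<C> A) ?n \<cdot> a = idn \<C> A" "a \<cdot> add A A (idn \<C> A) ?n = idn \<C> A"
    using add_cmp[OF assms(2) i n] cmp_add[OF i n assms(2)] cmp_idn_left[OF assms(2)]
      cmp_idn_right[OF assms(2)] add_comm[OF assms(2) n] a by simp_all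
  then show ?thesis using that[of "add A A (idn \<C> A) ?n"] arr_add[OF i n] by blast
qed

text \<open>Comparison maps over the identities of \<open>B\<close> and \<open>C\<close> come from
  the dual of (ET3). Inflations need not be monic, so their composites need not be identities; but
  each composite preserves the inflation and the extension, hence is invertible by
  \<open>endomorphism_inverse\<close>.\<close>

lemma fiber_unique:
  assumes "(A, x, B, y, C, \<delta>) \<in> etriangles \<C>" "(A', x', B, y, C, \<delta>') \<in> etriangles \<C>"
  obtains a b where "arr A A' a" "arr A' A b" "x' \<cdot> a = x" "x \<cdot> b = x'"
    "b \<cdot> a = idn \<C> A" "a \<cdot> b = idn \<C> A'"
proof -
  have cmp: "\<exists>a. arr X X' a \<and> z' \<cdot> a = z \<and> push \<C> C a \<epsilon> = \<epsilon>'"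
    if "(X, z, B, y, C, \<epsilon>) \<in> etriangles \<C>" "(X', z', B, y, C, \<epsilon>') \<in> etriangles \<C>" for X z X' z' \<epsilon> \<epsilon>'
  proof -
    note T = that
    note D = etriangleD[OF that(1)] and D' = etriangleD[OF that(2)]
    obtain a where a: "idn \<C> B \<cdot> z = z' \<cdot> a" "ext_morphism \<C> C X \<epsilon> C X' \<epsilon>' a (idn \<C> C)"
      using ET3_op[OF T idn_mor[OF D(2)] idn_mor[OF D(3)]] cmp_idn_left[OF D(6)]
        cmp_idn_right[OF D(6)] by auto
    then show ?thesis
      using cmp_idn_left[OF D(5)] D D' pull_idn[OF D'(1,3,4)] unfolding ext_morphism_def arr_def by auto
  qed
  obtain a where a: "arr A A' a" "x' \<cdot> a = x" "push \<C> C a \<delta> = \<delta>'" using cmp[OF assms] by blast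
  obtain b where b: "arr A' A b" "x \<cdot> b = x'" "push \<C> C b \<delta>' = \<delta>" using cmp[OF assms(2,1)] by blast
  note D = etriangleD[OF assms(1)] and D' = etriangleD[OF assms(2)]
  obtain u where u: "arr A A u" "u \<cdot> (b \<cdot> a) = idn \<C> A"
  proof (rule endomorphism_inverse[OF assms(1) arr_cmp[OF a(1) b(1)]])
    show "x \<cdot> b \<cdot> a = x" using assoc[OF a(1) b(1) D(5)] a b by simp
    show "push \<C> C (b \<cdot> a) \<delta> = \<delta>" using push_cmp[OF a(1) b(1) D(3,4)] a b by simp
  qed
  obtain v where v: "arr A' A' v" "(a \<cdot> b) \<cdot> v = idn \<C> A'"
  proof (rule endomorphism_inverse[OF assms(2) arr_cmp[OF b(1) a(1)]])
    show "x' \<cdot> a \<cdot> b = x'" using assoc[OF b(1) a(1) D'(5)] a b by simp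
    show "push \<C> C (a \<cdot> b) \<delta>' = \<delta>'" using push_cmp[OF b(1) a(1) D'(3,4)] a b by simp
  qed
  \<comment> \<open>A left and a right inverse of \<open>a\<close>; they coincide and replace the
    original \<open>b\<close>.\<close>
  let ?b = "u \<cdot> b" and ?b' = "b \<cdot> v"
  have l: "?b \<cdot> a = idn \<C> A" using assoc[OF a(1) b(1) u(1)] u by simp
  have r: "a \<cdot> ?b' = idn \<C> A'" using assoc[OF v(1) b(1) a(1)] v by simp
  have B: "arr A' A ?b" "arr A' A ?b'" using u v b by blast+
  have "?b = ?b'"
    using assoc[OF B(2) a(1) B(1)] l r cmp_idn_left[OF B(2)] cmp_idn_right[OF B(1)] by simp
  moreover have "x \<cdot> ?b' = x'"
    using assoc[OF B(2) a(1) D'(5)] a(2) r cmp_idn_right[OF D'(5)] by simp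
  ultimately show ?thesis using that[OF a(1) B(2) a(2)] l r by simp
qed

text \<open>Dual to \<open>etriangle_exact\<close>: (ET3) is applied towards the split triangle
  \<open>0 -> W -> W\<close>.\<close>

lemma etriangle_coexact:
  assumes "(A, x, B, y, C, \<delta>) \<in> etriangles \<C>" "arr B W w" "w \<cdot> x = nul A W"
  obtains v where "arr C W v" "v \<cdot> y = w"
proof -
  note D = etriangleD[OF assms(1)]
  have W: "W \<in> Ob \<C>" using assms(2) arrD by blast
  obtain Z where Z: "zero_obj \<C> Z" using zero_exists by blast
  note ZO = zero_objD(1)[OF Z]
  have t: "(Z, nul Z W, W, idn \<C> W, W, \<one>\<^bsub>Ext \<C> W Z\<^esub>) \<in> etriangles \<C>"
    using etriangle_biproduct[OF biproduct_zero_left[OF Z W] ZO W] .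
  have "w \<cdot> x = nul Z W \<cdot> nul A Z"
    using assms(3) nul_cmp[OF arr_nul[OF D(1) ZO] W] by simp
  then obtain c where c: "c \<cdot> y = idn \<C> W \<cdot> w"
      "ext_morphism \<C> C A \<delta> W Z \<one>\<^bsub>Ext \<C> W Z\<^esub> (nul A Z) c"
    using ET3[OF assms(1) t arrD(3)[OF arr_nul[OF D(1) ZO]] arrD(3)[OF assms(2)]] by blast
  have "arr C W c" using c(2) D W unfolding ext_morphism_def arr_def by blast
  then show ?thesis using that c(1) cmp_idn_left[OF assms(2)] by simp
qed

text \<open>Exactness at the middle term holds for every E-triangle, by \<open>etriangle_cmp\<close>
  and \<open>etriangle_exact\<close>. Only injectivity on the left and surjectivity on the right are
  conditions.\<close>

lemma cov_exact_iff:
  assumes "(A, x, B, y, C, \<delta>) \<in> etriangles \<C>" "W \<in> Ob \<C>"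
  shows "cov_exact \<C> W (A, x, B, y, C, \<delta>) \<longleftrightarrow>
    (\<forall>v. arr W A v \<longrightarrow> x \<cdot> v = nul W B \<longrightarrow> v = nul W A) \<and>
    (\<forall>w. arr W C w \<longrightarrow> (\<exists>u. arr W B u \<and> y \<cdot> u = w))"
proof -
  note D = etriangleD[OF assms(1)]
  interpret f: group_hom "Hom \<C> W A" "Hom \<C> W B" "\<lambda>f. x \<cdot> f" by (rule hom_cmp_left[OF D(5) assms(2)])
  interpret g: group_hom "Hom \<C> W B" "Hom \<C> W C" "\<lambda>f. y \<cdot> f" by (rule hom_cmp_left[OF D(6) assms(2)])
  have "kernel (Hom \<C> W B) (Hom \<C> W C) (\<lambda>f. y \<cdot> f) = (\<lambda>f. x \<cdot> f) ` mor \<C> W A"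
  proof (intro equalityI subsetI)
    fix w assume w: "w \<in> kernel (Hom \<C> W B) (Hom \<C> W C) (\<lambda>f. y \<cdot> f)"
    then have "arr W B w" "y \<cdot> w = nul W C" using assms(2) D by (auto simp: kernel_def arr_def)
    then obtain v where "arr W A v" "x \<cdot> v = w" using etriangle_exact[OF assms(1)] by blast
    then show "w \<in> (\<lambda>f. x \<cdot> f) ` mor \<C> W A" by (auto simp: arr_def)
  next
    fix w assume "w \<in> (\<lambda>f. x \<cdot> f) ` mor \<C> W A"
    then obtain v where v: "arr W A v" "w = x \<cdot> v" using assms(2) D by (auto simp: arr_def)
    have "y \<cdot> w = nul W C"
      using assoc[OF v(1) D(5,6)] v etriangle_cmp[OF assms(1)] nul_cmp[OF v(1) D(3)] by simp
    then show "w \<in> kernel (Hom \<C> W B) (Hom \<C> W C) (\<lambda>f. y \<cdot> f)"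
      using arrD(3)[OF arr_cmp[OF v(1) D(5)]] v(2) by (simp add: kernel_def)
  qed
  moreover have "(\<lambda>f. x \<cdot> f) \<in> mon (Hom \<C> W A) (Hom \<C> W B) \<longleftrightarrow>
      (\<forall>v. arr W A v \<longrightarrow> x \<cdot> v = nul W B \<longrightarrow> v = nul W A)"
    using f.inj_on_one_iff assms(2) D(1) f.homh by (auto simp: mon_def arr_def)
  moreover have "(\<lambda>f. y \<cdot> f) \<in> epi (Hom \<C> W B) (Hom \<C> W C) \<longleftrightarrow>
      (\<forall>w. arr W C w \<longrightarrow> (\<exists>u. arr W B u \<and> y \<cdot> u = w))"
    using assms(2) D(2,3) g.homh unfolding epi_def arr_def
    by (auto simp: image_iff) (metis imageE)
  ultimately show ?thesis
    using f.group_hom_axioms g.group_hom_axioms g.H.is_group g.homh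
    unfolding cov_exact_def short_exact_sequence_iff by auto
qed

lemma contra_exact_iff:
  assumes "(A, x, B, y, C, \<delta>) \<in> etriangles \<C>" "W \<in> Ob \<C>"
  shows "contra_exact \<C> W (A, x, B, y, C, \<delta>) \<longleftrightarrow>
    (\<forall>v. arr C W v \<longrightarrow> v \<cdot> y = nul B W \<longrightarrow> v = nul C W) \<and>
    (\<forall>w. arr A W w \<longrightarrow> (\<exists>u. arr B W u \<and> u \<cdot> x = w))"
proof -
  note D = etriangleD[OF assms(1)]
  interpret f: group_hom "Hom \<C> C W" "Hom \<C> B W" "\<lambda>f. f \<cdot> y" by (rule hom_cmp_right[OF D(6) assms(2)])
  interpret g: group_hom "Hom \<C> B W" "Hom \<C> A W" "\<lambda>f. f \<cdot> x" by (rule hom_cmp_right[OF D(5) assms(2)])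
  have "kernel (Hom \<C> B W) (Hom \<C> A W) (\<lambda>f. f \<cdot> x) = (\<lambda>f. f \<cdot> y) ` mor \<C> C W"
  proof (intro equalityI subsetI)
    fix w assume w: "w \<in> kernel (Hom \<C> B W) (Hom \<C> A W) (\<lambda>f. f \<cdot> x)"
    then have "arr B W w" "w \<cdot> x = nul A W" using assms(2) D by (auto simp: kernel_def arr_def)
    then obtain v where "arr C W v" "v \<cdot> y = w" using etriangle_coexact[OF assms(1)] by blast
    then show "w \<in> (\<lambda>f. f \<cdot> y) ` mor \<C> C W" by (auto simp: arr_def)
  next
    fix w assume "w \<in> (\<lambda>f. f \<cdot> y) ` mor \<C> C W"
    then obtain v where v: "arr C W v" "w = v \<cdot> y" using assms(2) D by (auto simp: arr_def)
    have "w \<cdot> x = nul A W"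
      using assoc[OF D(5,6) v(1)] v etriangle_cmp[OF assms(1)] cmp_nul[OF v(1) D(1)] by simp
    then show "w \<in> kernel (Hom \<C> B W) (Hom \<C> A W) (\<lambda>f. f \<cdot> x)"
      using arrD(3)[OF arr_cmp[OF D(6) v(1)]] v(2) by (simp add: kernel_def)
  qed
  moreover have "(\<lambda>f. f \<cdot> y) \<in> mon (Hom \<C> C W) (Hom \<C> B W) \<longleftrightarrow>
      (\<forall>v. arr C W v \<longrightarrow> v \<cdot> y = nul B W \<longrightarrow> v = nul C W)"
    using f.inj_on_one_iff assms(2) D(3) f.homh by (auto simp: mon_def arr_def)
  moreover have "(\<lambda>f. f \<cdot> x) \<in> epi (Hom \<C> B W) (Hom \<C> A W) \<longleftrightarrow>
      (\<forall>w. arr A W w \<longrightarrow> (\<exists>u. arr B W u \<and> u \<cdot> x = w))"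
    using assms(2) D(1,2) g.homh unfolding epi_def arr_def
    by (auto simp: image_iff) (metis imageE)
  ultimately show ?thesis
    using f.group_hom_axioms g.group_hom_axioms g.H.is_group g.homh
    unfolding contra_exact_def short_exact_sequence_iff by auto
qed

section \<open>Sums with an identity, and weak pullbacks\<close>

lemma etriangle_sum_idn:
  assumes "(K, g, G, f, C, \<gamma>) \<in> etriangles \<C>" "B \<in> Ob \<C>"
    and S: "biproduct \<C> G B S i p j q" and T: "biproduct \<C> C B T k r l s"
  obtains w where "arr S T w" "(K, i \<cdot> g, S, w, T, pull \<C> r K \<gamma>) \<in> etriangles \<C>"
    "w \<cdot> i = k \<cdot> f" "w \<cdot> j = l" "r \<cdot> w = f \<cdot> p" "s \<cdot> w = q"
proof -
  note D = etriangleD[OF assms(1)]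
  note bS = biproductD[OF S D(2) assms(2)] and bT = biproductD[OF T D(3) assms(2)]
  obtain Z where Z: "zero_obj \<C> Z" using zero_exists by blast
  note ZO = zero_objD(1)[OF Z]
  \<comment> \<open>\<open>K\<close> itself serves as the sum of \<open>K\<close> and 0, so adding
    the split triangle \<open>0 -> B -> B\<close> leaves the fiber literally unchanged.\<close>
  note bK = biproduct_zero_right[OF Z D(1)]
  have t: "(Z, nul Z B, B, idn \<C> B, B, \<one>\<^bsub>Ext \<C> B Z\<^esub>) \<in> etriangles \<C>"
    using etriangle_biproduct[OF biproduct_zero_left[OF Z assms(2)] ZO assms(2)] .
  define v where "v = sum_mor \<C> K (idn \<C> K) (nul K Z) S i j g (nul Z B)"
  define w where "w = sum_mor \<C> S p q T k l f (idn \<C> B)"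
  note V = sum_morD[OF bK D(1) ZO S D(2) assms(2) D(5) arr_nul[OF ZO assms(2)], folded v_def]
  note W = sum_morD[OF S D(2) assms(2) T D(3) assms(2) D(6) arr_idn[OF assms(2)], folded w_def]
  have v: "v = i \<cdot> g" using V(2) cmp_idn_right[OF V(1)] by simp
  have gp: "pull \<C> r K \<gamma> \<in> ext \<C> T K" using pull_closed[OF bT(3) D(1,4)] .
  interpret E: comm_group "Ext \<C> T K" using bT(1) D(1) by (rule ext_group)
  \<comment> \<open>The second summand is the image of a zero extension and vanishes.\<close>
  have "sum_ext \<C> T r s K (idn \<C> K) (nul Z K) \<gamma> \<one>\<^bsub>Ext \<C> B Z\<^esub> = pull \<C> r K \<gamma>"
    using Emap_one[OF arr_nul[OF ZO D(1)] bT(5)] gp unfolding sum_ext_def pull_def by simp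
  then have "(K, i \<cdot> g, S, w, T, pull \<C> r K \<gamma>) \<in> etriangles \<C>"
    using ET2_sum[OF assms(1) t bK S T] D(1) bS(1) bT(1) gp v
    by (simp add: etriangles_def v_def w_def)
  then show ?thesis
    using that[OF W(1)] W(2-5) cmp_idn_right[OF bT(4)] cmp_idn_left[OF bS(5)] by simp
qed

text \<open>The map \<open>[f, -y] : G \<oplus> B \<rightarrow> C\<close> is a deflation for two reasons. It is the composite of
  \<open>f \<oplus> 1\<close> and the split deflation \<open>[1, -y]\<close>, so that the dual of (ET4) exhibits its fiber
  as the middle term of a triangle \<open>K \<rightarrow> E \<rightarrow> B\<close>; and an automorphism of \<open>G \<oplus> B\<close> built from \<open>h\<close>
  turns it into \<open>[0, y]\<close>, whose fiber is \<open>G \<oplus> A\<close>. Uniqueness of fibers identifies the two.\<close>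

lemma weak_pullback_biproduct:
  assumes t1: "(A, x, B, y, C, \<delta>) \<in> etriangles \<C>" and t2: "(K, g, G, f, C, \<gamma>) \<in> etriangles \<C>"
    and h: "arr G B h" "y \<cdot> h = f"
  obtains E s p r q e d where "biproduct \<C> A G E s p r q"
    "(K, e, E, d, B, pull \<C> y K \<gamma>) \<in> etriangles \<C>" "d \<cdot> s = x" "d \<cdot> r = h" "q \<cdot> e = g"
proof -
  note D = etriangleD[OF t1] and D' = etriangleD[OF t2]
  obtain S iS pS jS qS where S: "biproduct \<C> G B S iS pS jS qS"
    using biproduct_exists[OF D'(2) D(2)] by blast
  obtain T iT pT jT qT where T: "biproduct \<C> C B T iT pT jT qT"
    using biproduct_exists[OF D(3,2)] by blast
  obtain U iU pU jU qU where U: "biproduct \<C> G A U iU pU jU qU"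
    using biproduct_exists[OF D'(2) D(1)] by blast
  note bS = biproductD[OF S D'(2) D(2)] and bT = biproductD[OF T D(3,2)]
    and bU = biproductD[OF U D'(2) D(1)]
  note iB = arr_idn[OF D(2)] and iC = arr_idn[OF D(3)] and iG = arr_idn[OF D'(2)]
  note ny = arr_neg[OF D(6)] and njS = arr_neg[OF bS(4)]
  obtain \<psi> where \<psi>: "arr S T \<psi>" "(K, iS \<cdot> g, S, \<psi>, T, pull \<C> pT K \<gamma>) \<in> etriangles \<C>"
      "\<psi> \<cdot> iS = iT \<cdot> f" "\<psi> \<cdot> jS = jT" "pT \<cdot> \<psi> = f \<cdot> pS" "qT \<cdot> \<psi> = qS"
    using etriangle_sum_idn[OF t2 D(2) S T] .
  \<comment> \<open>\<open>m\<close> is the graph of \<open>y\<close> in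
    \<open>C \<oplus> B\<close>, and \<open>n\<close> below is \<open>[1, -y]\<close>, which
    annihilates it.\<close>
  obtain m where m: "arr B T m" "pT \<cdot> m = y" "qT \<cdot> m = idn \<C> B"
    using biproduct_pair[OF T D(3,2) D(6) iB] .
  obtain n where n: "arr T C n" "n \<cdot> iT = idn \<C> C" "n \<cdot> jT = neg B C y"
    using biproduct_copair[OF T D(3,2) iC ny] .
  have nT: "n = add T C pT (neg B C y \<cdot> qT)"
  proof (rule biproduct_ext_from[OF T D(3,2) n(1)])
    show "arr T C (add T C pT (neg B C y \<cdot> qT))" using bT ny by blast
    show "n \<cdot> iT = add T C pT (neg B C y \<cdot> qT) \<cdot> iT"
      using add_cmp[OF bT(2,3) arr_cmp[OF bT(5) ny]] assoc[OF bT(2,5) ny] bT(6,9)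
        cmp_nul[OF ny D(3)] add_nul_right[OF iC] n(2) by simp
    show "n \<cdot> jT = add T C pT (neg B C y \<cdot> qT) \<cdot> jT"
      using add_cmp[OF bT(4,3) arr_cmp[OF bT(5) ny]] assoc[OF bT(4,5) ny] bT(7,8)
        cmp_idn_right[OF ny] add_nul_left[OF ny] n(3) by simp
  qed
  have nm: "n \<cdot> m = nul B C"
    using add_cmp[OF m(1) bT(3) arr_cmp[OF bT(5) ny]] assoc[OF m(1) bT(5) ny] m(2,3)
      cmp_idn_right[OF ny] add_neg(1)[OF D(6)] nT by simp
  \<comment> \<open>A change of coordinates on \<open>T\<close>: the graph of \<open>y\<close>
    replaces the summand \<open>B\<close>. Thus \<open>n\<close> is a split deflation with fiber
    \<open>m\<close>.\<close>
  have "biproduct \<C> B C T m qT iT n"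
  proof (rule biproductI[OF m(1) bT(5,2) n(1) m(3) n(2) bT(9) nm])
    have mq: "arr T T (m \<cdot> qT)" and iTn: "arr T T (iT \<cdot> n)" using m(1) n(1) bT by blast+
    show "add T T (m \<cdot> qT) (iT \<cdot> n) = idn \<C> T"
    proof (rule biproduct_ext_from[OF T D(3,2) arr_add[OF mq iTn] arr_idn[OF bT(1)]])
      show "add T T (m \<cdot> qT) (iT \<cdot> n) \<cdot> iT = idn \<C> T \<cdot> iT"
        using add_cmp[OF bT(2) mq iTn] assoc[OF bT(2,5) m(1)] assoc[OF bT(2) n(1) bT(2)] bT(9) n(2)
          cmp_nul[OF m(1) D(3)] cmp_idn_right[OF bT(2)] cmp_idn_left[OF bT(2)] add_nul_left[OF bT(2)]
        by simp
      have im: "arr B T (iT \<cdot> neg B C y)" using ny bT(2) by blast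
      have "add T T (m \<cdot> qT) (iT \<cdot> n) \<cdot> jT = add B T m (iT \<cdot> neg B C y)"
        using add_cmp[OF bT(4) mq iTn] assoc[OF bT(4,5) m(1)] assoc[OF bT(4) n(1) bT(2)] bT(7) n(3)
          cmp_idn_right[OF m(1)] by simp
      also have "\<dots> = jT"
      proof (rule biproduct_ext_to[OF T D(3,2) arr_add[OF m(1) im] bT(4)])
        show "pT \<cdot> add B T m (iT \<cdot> neg B C y) = pT \<cdot> jT"
          using cmp_add[OF m(1) im bT(3)] assoc[OF ny bT(2,3)] bT(6,8) cmp_idn_left[OF ny]
            add_neg(1)[OF D(6)] m(2) by simp
        show "qT \<cdot> add B T m (iT \<cdot> neg B C y) = qT \<cdot> jT"
          using cmp_add[OF m(1) im bT(5)] assoc[OF ny bT(2,5)] bT(7,9) nul_cmp[OF ny D(2)]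
            add_nul_right[OF iB] m(3) by simp
      qed
      finally show "add T T (m \<cdot> qT) (iT \<cdot> n) \<cdot> jT = idn \<C> T \<cdot> jT"
        using cmp_idn_left[OF bT(4)] by simp
    qed
  qed
  then have tB: "(B, m, T, n, C, \<one>\<^bsub>Ext \<C> C B\<^esub>) \<in> etriangles \<C>"
    using etriangle_biproduct D(2,3) by blast
  \<comment> \<open>First reading of the fiber of \<open>[f, -y]\<close>. The extension of
    \<open>B\<close> by \<open>K\<close> is pulled back along \<open>m\<close> and then
    \<open>pT\<close>, that is, along \<open>pT \<cdot> m = y\<close>.\<close>
  obtain E h' d e \<delta>E where E: "(E, h', S, n \<cdot> \<psi>, C, \<delta>E) \<in> etriangles \<C>"
      "(K, e, E, d, B, pull \<C> m K (pull \<C> pT K \<gamma>)) \<in> etriangles \<C>"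
      "\<psi> \<cdot> h' = m \<cdot> d" "h' \<cdot> e = iS \<cdot> g"
    using ET4_op[OF tB \<psi>(2)] by blast
  have KE: "(K, e, E, d, B, pull \<C> y K \<gamma>) \<in> etriangles \<C>"
    using E(2) pull_cmp[OF bT(3) m(1) D'(1,4)] m(2) by simp
  note h' = etriangleD(5)[OF E(1)] and de = etriangleD(5,6)[OF E(2)]
    and v = etriangleD(6)[OF E(1)] and EO = etriangleD(1)[OF E(1)]
  \<comment> \<open>\<open>d\<close> is the \<open>B\<close>-component of the fiber inclusion
    \<open>h'\<close>; the \<open>G\<close>-component will be the projection \<open>q\<close>, and
    the next fact is its compatibility with \<open>g\<close>.\<close>
  have d: "d = qS \<cdot> h'"
    using assoc[OF de(2) m(1) bT(5)] assoc[OF h' \<psi>(1) bT(5)] m(3) \<psi>(6) E(3)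
      cmp_idn_left[OF de(2)] by simp
  have h1e: "(pS \<cdot> h') \<cdot> e = g"
    using assoc[OF de(1) h' bS(3)] assoc[OF D'(5) bS(2,3)] E(4) bS(6) cmp_idn_left[OF D'(5)] by simp
  have vS: "(n \<cdot> \<psi>) \<cdot> iS = f" "(n \<cdot> \<psi>) \<cdot> jS = neg B C y"
    using assoc[OF bS(2) \<psi>(1) n(1)] assoc[OF bS(4) \<psi>(1) n(1)] assoc[OF D'(6) bT(2) n(1)] \<psi>(3,4) n(2,3)
      cmp_idn_left[OF D'(6)] by simp_all

  obtain Z where Z: "zero_obj \<C> Z" using zero_exists by blast
  note ZO = zero_objD(1)[OF Z]
  note bC = biproduct_zero_left[OF Z D(3)]
  \<comment> \<open>Second reading: the sum of \<open>G -> G -> 0\<close> and the given triangle has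
    deflation \<open>[0, y]\<close> and fiber \<open>G \<oplus> A\<close>, with \<open>C\<close>
    serving as the sum of 0 and \<open>C\<close>.\<close>
  have tG: "(G, idn \<C> G, G, nul G Z, Z, \<one>\<^bsub>Ext \<C> Z G\<^esub>) \<in> etriangles \<C>"
    using etriangle_biproduct[OF biproduct_zero_right[OF Z D'(2)] D'(2) ZO] .
  define u where "u = sum_mor \<C> U pU qU S iS jS (idn \<C> G) x"
  define v0 where "v0 = sum_mor \<C> S pS qS C (nul Z C) (idn \<C> C) (nul G Z) y"
  note u = sum_morD[OF U D'(2) D(1) S D'(2) D(2) iG D(5), folded u_def]
  note v0 = sum_morD[OF S D'(2) D(2) bC ZO D(3) arr_nul[OF D'(2) ZO] D(6), folded v0_def]
  obtain \<delta>U where tU: "(U, u, S, v0, C, \<delta>U) \<in> etriangles \<C>"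
  proof -
    have "(u, S, v0) \<in> Real \<C> C U (sum_ext \<C> C (nul C Z) (idn \<C> C) U iU jU \<one>\<^bsub>Ext \<C> Z G\<^esub> \<delta>)"
      using ET2_sum[OF tG t1 U S bC] unfolding u_def v0_def .
    moreover have "sum_ext \<C> C (nul C Z) (idn \<C> C) U iU jU \<one>\<^bsub>Ext \<C> Z G\<^esub> \<delta> \<in> ext \<C> C U"
    proof -
      interpret X: comm_group "Ext \<C> C U" using D(3) bU(1) by (rule ext_group)
      show ?thesis unfolding sum_ext_def
        using Emap_closed[OF bU(4) iC D(4)] Emap_closed[OF bU(2) arr_nul[OF D(3) ZO]
          etriangleD(4)[OF tG]] by simp
    qed
    ultimately show ?thesis using that bU(1) bS(1) D(3) by (auto simp: etriangles_def)
  qed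
  let ?a = "add G S iS (jS \<cdot> h)"
  note jh = arr_cmp[OF h(1) bS(4)]
  have a: "arr G S ?a" using bS(2) jh by blast
  \<comment> \<open>The matrix with rows (1, 0) and (h, -1) is an involution; as
    \<open>y \<cdot> h = f\<close>, it turns \<open>[f, -y]\<close> into
    \<open>[0, y]\<close>.\<close>
  obtain \<phi> where \<phi>: "arr S S \<phi>" "\<phi> \<cdot> iS = ?a" "\<phi> \<cdot> jS = neg B S jS"
    using biproduct_copair[OF S D'(2) D(2) a njS] .
  have "\<phi> \<cdot> \<phi> = idn \<C> S"
  proof (rule biproduct_ext_from[OF S D'(2) D(2) arr_cmp[OF \<phi>(1,1)] arr_idn[OF bS(1)]])
    have "\<phi> \<cdot> ?a = add G S ?a (neg G S (jS \<cdot> h))"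
      using cmp_add[OF bS(2) jh \<phi>(1)] assoc[OF h(1) bS(4) \<phi>(1)] \<phi>(2,3) neg_cmp[OF h(1) bS(4)] by simp
    also have "\<dots> = iS"
      using add_assoc[OF bS(2) jh arr_neg[OF jh]] add_neg(1)[OF jh] add_nul_right[OF bS(2)] by simp
    finally show "(\<phi> \<cdot> \<phi>) \<cdot> iS = idn \<C> S \<cdot> iS"
      using assoc[OF bS(2) \<phi>(1,1)] \<phi>(2) cmp_idn_left[OF bS(2)] by simp
    show "(\<phi> \<cdot> \<phi>) \<cdot> jS = idn \<C> S \<cdot> jS"
      using assoc[OF bS(4) \<phi>(1,1)] \<phi>(3) cmp_neg[OF bS(4) \<phi>(1)] neg_neg[OF bS(4)]
        cmp_idn_left[OF bS(4)] by simp
  qed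
  then have \<phi>_iso: "iso_mor \<C> S S \<phi>" using iso_morI[OF \<phi>(1,1)] by simp
  have v\<phi>: "(n \<cdot> \<psi>) \<cdot> \<phi> = v0"
  proof (rule biproduct_ext_from[OF S D'(2) D(2) arr_cmp[OF \<phi>(1) v] v0(1)])
    have "(n \<cdot> \<psi>) \<cdot> ?a = nul G C"
      using cmp_add[OF bS(2) jh v] assoc[OF h(1) bS(4) v] vS neg_cmp[OF h(1) D(6)] h(2)
        add_neg(1)[OF D'(6)] by simp
    then show "((n \<cdot> \<psi>) \<cdot> \<phi>) \<cdot> iS = v0 \<cdot> iS"
      using assoc[OF bS(2) \<phi>(1) v] \<phi>(2) v0(2) cmp_nul[OF arr_nul[OF ZO D(3)] D'(2)] by simp
    show "((n \<cdot> \<psi>) \<cdot> \<phi>) \<cdot> jS = v0 \<cdot> jS"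
      using assoc[OF bS(4) \<phi>(1) v] \<phi>(3) cmp_neg[OF bS(4) v] vS(2) neg_neg[OF D(6)] v0(3)
        cmp_idn_left[OF D(6)] by simp
  qed
  obtain \<theta> \<theta>' where \<theta>: "arr U E \<theta>" "arr E U \<theta>'" "h' \<cdot> \<theta> = \<phi> \<cdot> u"
      "\<theta>' \<cdot> \<theta> = idn \<C> U" "\<theta> \<cdot> \<theta>' = idn \<C> E"
    using fiber_unique[OF etriangle_iso_middle[OF tU \<phi>(1) \<phi>_iso v v\<phi>] E(1)] by metis
  note bE = biproduct_iso[OF U D'(2) D(1) \<theta>(1,2,4,5)]
  note bE' = biproductD[OF bE D'(2) D(1)]
  \<comment> \<open>Reads off the components of \<open>h'\<close> in the coordinates that \<theta>
    puts on \<open>E\<close>; the -1 in \<phi> makes \<open>A\<close> enter with a sign.\<close>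
  have comp: "(k \<cdot> h') \<cdot> (\<theta> \<cdot> iU) = k \<cdot> ?a" "(k \<cdot> h') \<cdot> (\<theta> \<cdot> jU) = (k \<cdot> neg B S jS) \<cdot> x"
    if k: "arr S X k" for k X
  proof -
    have "(k \<cdot> h') \<cdot> (\<theta> \<cdot> w) = k \<cdot> (\<phi> \<cdot> (u \<cdot> w))" if w: "arr Y U w" for Y w
      using assoc[OF arr_cmp[OF w \<theta>(1)] h' k] assoc[OF w \<theta>(1) h'] \<theta>(3) assoc[OF w u(1) \<phi>(1)] by simp
    then show "(k \<cdot> h') \<cdot> (\<theta> \<cdot> iU) = k \<cdot> ?a" "(k \<cdot> h') \<cdot> (\<theta> \<cdot> jU) = (k \<cdot> neg B S jS) \<cdot> x"
      using bU(2,4) u(2,3) cmp_idn_right[OF bS(2)] \<phi>(2,3) assoc[OF D(5) bS(4) \<phi>(1)] assoc[OF D(5) njS k]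
      by simp_all
  qed
  have "pS \<cdot> h' = pU \<cdot> \<theta>'"
  proof (rule biproduct_ext_from[OF bE D'(2) D(1) arr_cmp[OF h' bS(3)] bE'(3)])
    have "pS \<cdot> ?a = idn \<C> G"
      using cmp_add[OF bS(2) jh bS(3)] assoc[OF h(1) bS(4,3)] bS(6,8) nul_cmp[OF h(1) D'(2)]
        add_nul_right[OF iG] by simp
    then show "(pS \<cdot> h') \<cdot> (\<theta> \<cdot> iU) = (pU \<cdot> \<theta>') \<cdot> (\<theta> \<cdot> iU)"
      using comp(1)[OF bS(3)] bE'(6) by simp
    have "pS \<cdot> neg B S jS = nul B G"
      using cmp_neg[OF bS(4,3)] bS(8) neg_unique[of B G "nul B G" "nul B G"]
        add_nul_left[OF arr_nul[OF D(2) D'(2)]] arr_nul[OF D(2) D'(2)] by simp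
    then show "(pS \<cdot> h') \<cdot> (\<theta> \<cdot> jU) = (pU \<cdot> \<theta>') \<cdot> (\<theta> \<cdot> jU)"
      using comp(2)[OF bS(3)] bE'(8) nul_cmp[OF D(5) D'(2)] by simp
  qed
  \<comment> \<open>The injection of \<open>A\<close> is negated, so that \<open>d\<close> restricts
    to \<open>x\<close> instead of its negative.\<close>
  then have bA: "biproduct \<C> A G E (neg A E (\<theta> \<cdot> jU)) (neg E A (qU \<cdot> \<theta>')) (\<theta> \<cdot> iU) (pS \<cdot> h')"
    using biproduct_neg[OF biproduct_swap[OF bE D'(2) D(1)] D(1) D'(2)] by simp
  have "d \<cdot> (\<theta> \<cdot> iU) = h"
    using comp(1)[OF bS(5)] d cmp_add[OF bS(2) jh bS(5)] assoc[OF h(1) bS(4,5)] bS(7,9)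
      cmp_idn_left[OF h(1)] add_nul_left[OF h(1)] by simp
  moreover have "d \<cdot> neg A E (\<theta> \<cdot> jU) = x"
    using comp(2)[OF bS(5)] d cmp_neg[OF bE'(4) de(2)] cmp_neg[OF bS(4,5)] bS(7)
      neg_cmp[OF D(5) iB] cmp_idn_left[OF D(5)] neg_neg[OF D(5)] by simp
  ultimately show ?thesis using that[OF bA KE _ _ h1e] by simp
qed

end

section \<open>The horseshoe step\<close>

context proper_class
begin

lemma proper_etriangle: "T \<in> \<xi> \<Longrightarrow> T \<in> etriangles \<C>"
  using etriangle by blast

lemma cov_exact_inj:
  assumes "cov_exact \<C> W (A, x, B, y, C, \<delta>)" "(A, x, B, y, C, \<delta>) \<in> \<xi>" "arr W A u" "arr W A v"
    and "x \<cdot> u = x \<cdot> v"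
  shows "u = v"
proof -
  note D = etriangleD[OF proper_etriangle[OF assms(2)]]
  have W: "W \<in> Ob \<C>" using assms(3) arrD by blast
  note nv = arr_neg[OF assms(4)]
  have "x \<cdot> add W A u (neg W A v) = nul W B"
    using cmp_add[OF assms(3) nv D(5)] cmp_neg[OF assms(4) D(5)] assms(5)
      add_neg(1)[OF arr_cmp[OF assms(4) D(5)]] by simp
  then have "add W A u (neg W A v) = nul W A"
    using assms(1) cov_exact_iff[OF proper_etriangle[OF assms(2)] W] arr_add[OF assms(3) nv] by blast
  then show ?thesis using diff_eq_nul[OF assms(3,4)] by simp
qed

lemma cov_exact_lift:
  assumes "cov_exact \<C> W (A, x, B, y, C, \<delta>)" "(A, x, B, y, C, \<delta>) \<in> \<xi>" "arr W C w"
  obtains u where "arr W B u" "y \<cdot> u = w"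
  using assms cov_exact_iff[OF proper_etriangle[OF assms(2)] arrD(1)[OF assms(3)]] by blast

lemma horseshoe_step:
  assumes t: "(A, x, B, y, C, \<delta>) \<in> \<xi>"
    and tA: "(KA, gA, GA, fA, A, \<alpha>) \<in> \<xi>" and tC: "(KC, gC, GC, fC, C, \<gamma>) \<in> \<xi>"
    and P: "biproduct \<C> GA GC P i p j q"
    and lift: "arr GC B h" "y \<cdot> h = fC"
  obtains KB gB fB \<beta> e d \<kappa> where "(KB, gB, P, fB, B, \<beta>) \<in> \<xi>" "(KA, e, KB, d, KC, \<kappa>) \<in> \<xi>"
    "gB \<cdot> e = i \<cdot> gA" "q \<cdot> gB = gC \<cdot> d" "fB \<cdot> i = x \<cdot> fA" "fB \<cdot> j = h" "y \<cdot> fB = fC \<cdot> q"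
proof -
  note et = proper_etriangle[OF t] proper_etriangle[OF tA] proper_etriangle[OF tC]
  note D = etriangleD[OF et(1)] and DA = etriangleD[OF et(2)] and DC = etriangleD[OF et(3)]
  note bP = biproductD[OF P DA(2) DC(2)]
  \<comment> \<open>\<open>E\<close> is \<open>A \<oplus> GC\<close> and \<open>m\<close> is
    \<open>[x, h]\<close>; the fiber of \<open>m\<close> is \<open>KC\<close>.\<close>
  obtain E s p' r q' k m where E: "biproduct \<C> A GC E s p' r q'"
      "(KC, k, E, m, B, pull \<C> y KC \<gamma>) \<in> etriangles \<C>" "m \<cdot> s = x" "m \<cdot> r = h" "q' \<cdot> k = gC"
    using weak_pullback_biproduct[OF et(1,3) lift] .
  note bE = biproductD[OF E(1) D(1) DC(2)]
  note DE = etriangleD[OF E(2)]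
  obtain w where w: "arr P E w" "(KA, i \<cdot> gA, P, w, E, pull \<C> p' KA \<alpha>) \<in> etriangles \<C>"
      "w \<cdot> i = s \<cdot> fA" "w \<cdot> j = r" "q' \<cdot> w = q"
    using etriangle_sum_idn[OF et(2) DC(2) P E(1)] .
  obtain KB gB d e \<beta> where B: "(KB, gB, P, m \<cdot> w, B, \<beta>) \<in> etriangles \<C>"
      "(KA, e, KB, d, KC, pull \<C> k KA (pull \<C> p' KA \<alpha>)) \<in> etriangles \<C>"
      "w \<cdot> gB = k \<cdot> d" "gB \<cdot> e = i \<cdot> gA" "pull \<C> m KB \<beta> = push \<C> E e (pull \<C> p' KA \<alpha>)"
    using ET4_op[OF E(2) w(2)] by blast
  note DB = etriangleD[OF B(1)] and DK = etriangleD[OF B(2)]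
  \<comment> \<open>All three triangles are base changes: of the column over \<open>C\<close>, of
    the column over \<open>A\<close>, and of the second of these along \<open>k\<close>.\<close>
  have E\<xi>: "(KC, k, E, m, B, pull \<C> y KC \<gamma>) \<in> \<xi>"
    by (rule base_change[OF tC D(2) arrD(3)[OF D(6)] E(2)])
  have w\<xi>: "(KA, i \<cdot> gA, P, w, E, pull \<C> p' KA \<alpha>) \<in> \<xi>"
    by (rule base_change[OF tA bE(1) arrD(3)[OF bE(3)] w(2)])
  have K\<xi>: "(KA, e, KB, d, KC, pull \<C> k KA (pull \<C> p' KA \<alpha>)) \<in> \<xi>"
    by (rule base_change[OF w\<xi> DE(1) arrD(3)[OF DE(5)] B(2)])
  \<comment> \<open>Saturation along the deflation \<open>m\<close> asks for a triangle in \<xi>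
    realizing \<open>pull \<C> m KB \<beta>\<close>. By the dual of (ET4) this extension is the
    pushforward along \<open>e\<close> of the one for \<open>w\<close>, so cobase change supplies
    such a triangle.\<close>
  have "push \<C> E e (pull \<C> p' KA \<alpha>) \<in> ext \<C> E KB"
    using push_closed[OF DK(5) bE(1)] etriangleD(4)[OF w(2)] by simp
  then obtain u M v where "(KB, u, M, v, E, push \<C> E e (pull \<C> p' KA \<alpha>)) \<in> etriangles \<C>"
    using realization_exists[OF DB(1) bE(1)] by blast
  then have "(KB, u, M, v, E, pull \<C> m KB \<beta>) \<in> \<xi>"
    using cobase_change[OF w\<xi> DB(1) arrD(3)[OF DK(5)]] B(5) by simp
  then have B\<xi>: "(KB, gB, P, m \<cdot> w, B, \<beta>) \<in> \<xi>"
    using saturated[OF B(1) E\<xi>] by blast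
  have "q \<cdot> gB = gC \<cdot> d"
    using assoc[OF DB(5) w(1) bE(5)] assoc[OF DK(6) DE(5) bE(5)] w(5) E(5) B(3) by simp
  moreover have fi: "(m \<cdot> w) \<cdot> i = x \<cdot> fA"
    using assoc[OF bP(2) w(1) DE(6)] assoc[OF DA(6) bE(2) DE(6)] w(3) E(3) by simp
  moreover have fj: "(m \<cdot> w) \<cdot> j = h"
    using assoc[OF bP(4) w(1) DE(6)] w(4) E(4) by simp
  \<comment> \<open>Tested on both summands: on \<open>GA\<close> both sides vanish since
    \<open>y \<cdot> x\<close> is zero, on \<open>GC\<close> this is the choice of the lift
    \<open>h\<close>.\<close>
  moreover have "y \<cdot> (m \<cdot> w) = fC \<cdot> q"
  proof (rule biproduct_ext_from[OF P DA(2) DC(2) arr_cmp[OF DB(6) D(6)] arr_cmp[OF bP(5) DC(6)]])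
    show "(y \<cdot> m \<cdot> w) \<cdot> i = (fC \<cdot> q) \<cdot> i"
      using assoc[OF bP(2) DB(6) D(6)] fi assoc[OF DA(6) D(5,6)] etriangle_cmp[OF et(1)]
        nul_cmp[OF DA(6) D(3)] assoc[OF bP(2,5) DC(6)] bP(9) cmp_nul[OF DC(6) DA(2)] by simp
    show "(y \<cdot> m \<cdot> w) \<cdot> j = (fC \<cdot> q) \<cdot> j"
      using assoc[OF bP(4) DB(6) D(6)] fj lift(2) assoc[OF bP(4,5) DC(6)] bP(7)
        cmp_idn_right[OF DC(6)] by simp
  qed
  ultimately show ?thesis using that[OF B\<xi> K\<xi> B(4)] by blast
qed

text \<open>A chase in the three-by-three diagram after applying Hom from \<open>W\<close>. The
  column gives properness of the new resolution; the row is the hypothesis for building the next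
  degree.\<close>

lemma horseshoe_exact:
  assumes t: "(A, x, B, y, C, \<delta>) \<in> \<xi>" "cov_exact \<C> W (A, x, B, y, C, \<delta>)"
    and tA: "(KA, gA, GA, fA, A, \<alpha>) \<in> \<xi>" "cov_exact \<C> W (KA, gA, GA, fA, A, \<alpha>)"
    and tC: "(KC, gC, GC, fC, C, \<gamma>) \<in> \<xi>" "cov_exact \<C> W (KC, gC, GC, fC, C, \<gamma>)"
    and P: "biproduct \<C> GA GC P i p j q"
    and tB: "(KB, gB, P, fB, B, \<beta>) \<in> \<xi>" and tK: "(KA, e, KB, d, KC, \<kappa>) \<in> \<xi>"
    and sq: "gB \<cdot> e = i \<cdot> gA" "q \<cdot> gB = gC \<cdot> d" "fB \<cdot> i = x \<cdot> fA" "y \<cdot> fB = fC \<cdot> q"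
    and W: "W \<in> Ob \<C>"
  shows "cov_exact \<C> W (KB, gB, P, fB, B, \<beta>)" "cov_exact \<C> W (KA, e, KB, d, KC, \<kappa>)"
proof -
  note et = t(1)[THEN proper_etriangle] tA(1)[THEN proper_etriangle] tC(1)[THEN proper_etriangle]
    tB[THEN proper_etriangle] tK[THEN proper_etriangle]
  note D = etriangleD[OF et(1)] and DA = etriangleD[OF et(2)] and DC = etriangleD[OF et(3)]
    and DB = etriangleD[OF et(4)] and DK = etriangleD[OF et(5)]
  note bP = biproductD[OF P DA(2) DC(2)]
  have e_inj: "v = nul W KA" if v: "arr W KA v" "e \<cdot> v = nul W KB" for v
  proof -
    have "i \<cdot> (gA \<cdot> v) = nul W P"
      using assoc[OF v(1) DK(5) DB(5)] assoc[OF v(1) DA(5) bP(2)] sq(1) v(2) cmp_nul[OF DB(5) W] by simp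
    then have "gA \<cdot> v = nul W GA"
      using assoc[OF arr_cmp[OF v(1) DA(5)] bP(2,3)] bP(6) cmp_idn_left[OF arr_cmp[OF v(1) DA(5)]]
        cmp_nul[OF bP(3) W] by simp
    then show ?thesis using cov_exact_inj[OF tA(2,1) v(1) arr_nul[OF W DA(1)]] cmp_nul[OF DA(5) W] by simp
  qed
  \<comment> \<open>Injectivity of \<open>gC\<close> kills the image of \<open>w\<close> in
    \<open>KC\<close>, so \<open>w\<close> comes from \<open>KA\<close>; there \<open>i\<close> is
    split and \<open>gA\<close> is injective on maps from \<open>W\<close>.\<close>
  have g_inj: "w = nul W KB" if w: "arr W KB w" "gB \<cdot> w = nul W P" for w
  proof -
    have "gC \<cdot> (d \<cdot> w) = nul W GC"
      using assoc[OF w(1) DK(6) DC(5)] assoc[OF w(1) DB(5) bP(5)] sq(2) w(2) cmp_nul[OF bP(5) W] by simp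
    then have "d \<cdot> w = nul W KC"
      using cov_exact_inj[OF tC(2,1) arr_cmp[OF w(1) DK(6)] arr_nul[OF W DC(1)]] cmp_nul[OF DC(5) W] by simp
    then obtain v where v: "arr W KA v" "e \<cdot> v = w" using etriangle_exact[OF et(5) w(1)] by blast
    have "i \<cdot> (gA \<cdot> v) = nul W P"
      using assoc[OF v(1) DK(5) DB(5)] assoc[OF v(1) DA(5) bP(2)] sq(1) v(2) w(2) by simp
    then have "gA \<cdot> v = nul W GA"
      using assoc[OF arr_cmp[OF v(1) DA(5)] bP(2,3)] bP(6) cmp_idn_left[OF arr_cmp[OF v(1) DA(5)]]
        cmp_nul[OF bP(3) W] by simp
    then have "v = nul W KA"
      using cov_exact_inj[OF tA(2,1) v(1) arr_nul[OF W DA(1)]] cmp_nul[OF DA(5) W] by simp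
    then show ?thesis using v(2) cmp_nul[OF DK(5) W] by simp
  qed
  \<comment> \<open>Maps into \<open>B\<close> and \<open>GC\<close> that agree over
    \<open>C\<close> have a common lift to \<open>P\<close>. The error of the candidate
    \<open>j \<cdot> c\<close> is killed by \<open>y\<close>, hence comes from \<open>A\<close>, and
    is corrected by a lift to \<open>GA\<close>.\<close>
  have correct: "\<exists>u. arr W P u \<and> fB \<cdot> u = w \<and> q \<cdot> u = c" if wc: "arr W B w" "arr W GC c" "y \<cdot> w = fC \<cdot> c" for w c
  proof -
    note jc = arr_cmp[OF wc(2) bP(4)]
    note fjc = arr_cmp[OF jc DB(6)]
    note nfjc = arr_neg[OF fjc]
    have "y \<cdot> (fB \<cdot> (j \<cdot> c)) = fC \<cdot> c"
      using assoc[OF jc DB(6) D(6)] sq(4) assoc[OF jc bP(5) DC(6)] assoc[OF wc(2) bP(4,5)] bP(7)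
        cmp_idn_left[OF wc(2)] by simp
    then have "y \<cdot> add W B w (neg W B (fB \<cdot> (j \<cdot> c))) = nul W C"
      using cmp_add[OF wc(1) nfjc D(6)] cmp_neg[OF fjc D(6)] wc(3)
        add_neg(1)[OF arr_cmp[OF wc(2) DC(6)]] by simp
    then obtain a where a: "arr W A a" "x \<cdot> a = add W B w (neg W B (fB \<cdot> (j \<cdot> c)))"
      using etriangle_exact[OF et(1) arr_add[OF wc(1) nfjc]] by blast
    obtain b where b: "arr W GA b" "fA \<cdot> b = a" using cov_exact_lift[OF tA(2,1) a(1)] .
    note ib = arr_cmp[OF b(1) bP(2)]
    have "fB \<cdot> (i \<cdot> b) = add W B w (neg W B (fB \<cdot> (j \<cdot> c)))"
      using assoc[OF b(1) bP(2) DB(6)] sq(3) assoc[OF b(1) DA(6) D(5)] a b by simp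
    then have "fB \<cdot> add W P (i \<cdot> b) (j \<cdot> c) = w"
      using cmp_add[OF ib jc DB(6)] add_assoc[OF wc(1) nfjc fjc] add_neg(2)[OF fjc]
        add_nul_right[OF wc(1)] by simp
    moreover have "q \<cdot> add W P (i \<cdot> b) (j \<cdot> c) = c"
      using cmp_add[OF ib jc bP(5)] assoc[OF b(1) bP(2,5)] assoc[OF wc(2) bP(4,5)] bP(7,9)
        nul_cmp[OF b(1) DC(2)] cmp_idn_left[OF wc(2)] add_nul_left[OF wc(2)] by simp
    ultimately show ?thesis using arr_add[OF ib jc] by blast
  qed
  have f_surj: "\<exists>u. arr W P u \<and> fB \<cdot> u = w" if w: "arr W B w" for w
  proof -
    obtain c where "arr W GC c" "fC \<cdot> c = y \<cdot> w"
      using cov_exact_lift[OF tC(2,1) arr_cmp[OF w D(6)]] .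
    then show ?thesis using correct[OF w] by metis
  qed
  \<comment> \<open>Apply \<open>correct\<close> to zero and \<open>gC \<cdot> w\<close>: the common
    lift is killed by \<open>fB\<close>, so it factors through \<open>KB\<close>, and injectivity of
    \<open>gC\<close> identifies its image.\<close>
  have d_surj: "\<exists>u. arr W KB u \<and> d \<cdot> u = w" if w: "arr W KC w" for w
  proof -
    note gw = arr_cmp[OF w DC(5)]
    have "y \<cdot> nul W B = fC \<cdot> (gC \<cdot> w)"
      using assoc[OF w DC(5,6)] etriangle_cmp[OF et(3)] nul_cmp[OF w D(3)] cmp_nul[OF D(6) W] by simp
    then obtain u where u: "arr W P u" "fB \<cdot> u = nul W B" "q \<cdot> u = gC \<cdot> w"
      using correct[OF arr_nul[OF W D(2)] gw] by blast
    obtain v where v: "arr W KB v" "gB \<cdot> v = u" using etriangle_exact[OF et(4) u(1,2)] .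
    have "gC \<cdot> (d \<cdot> v) = gC \<cdot> w"
      using assoc[OF v(1) DK(6) DC(5)] sq(2) assoc[OF v(1) DB(5) bP(5)] v(2) u(3) by simp
    then show ?thesis using cov_exact_inj[OF tC(2,1) arr_cmp[OF v(1) DK(6)] w] v(1) by blast
  qed
  show "cov_exact \<C> W (KB, gB, P, fB, B, \<beta>)"
    using cov_exact_iff[OF et(4) W] g_inj f_surj by blast
  show "cov_exact \<C> W (KA, e, KB, d, KC, \<kappa>)"
    using cov_exact_iff[OF et(5) W] e_inj d_surj by blast
qed

section \<open>Gorenstein projectives are closed under biproducts\<close>

text \<open>Both vanishing and lifting of maps out of \<open>S\<close> can be decided separately on
  the two summands.\<close>

lemma Proj_biproduct:
  assumes "P \<in> Proj \<C> \<xi>" "Q \<in> Proj \<C> \<xi>" and S: "biproduct \<C> P Q S i p j q"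
  shows "S \<in> Proj \<C> \<xi>"
proof -
  have o: "P \<in> Ob \<C>" "Q \<in> Ob \<C>" using assms unfolding Proj_def by auto
  note bS = biproductD[OF S o]
  have "cov_exact \<C> S (A, x, B, y, C, \<delta>)" if T: "(A, x, B, y, C, \<delta>) \<in> \<xi>" for A x B y C \<delta>
  proof -
    note et = proper_etriangle[OF T]
    note D = etriangleD[OF et]
    have PQ: "cov_exact \<C> P (A, x, B, y, C, \<delta>)" "cov_exact \<C> Q (A, x, B, y, C, \<delta>)"
      using assms(1,2) T unfolding Proj_def by auto
    have "v = nul S A" if v: "arr S A v" "x \<cdot> v = nul S B" for v
    proof (rule biproduct_ext_from[OF S o v(1) arr_nul[OF bS(1) D(1)]])
      have "x \<cdot> (v \<cdot> i) = x \<cdot> nul P A" "x \<cdot> (v \<cdot> j) = x \<cdot> nul Q A"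
        using assoc[OF bS(2) v(1) D(5)] assoc[OF bS(4) v(1) D(5)] v(2) nul_cmp[OF bS(2) D(2)]
          nul_cmp[OF bS(4) D(2)] cmp_nul[OF D(5) o(1)] cmp_nul[OF D(5) o(2)] by simp_all
      then show "v \<cdot> i = nul S A \<cdot> i" "v \<cdot> j = nul S A \<cdot> j"
        using cov_exact_inj[OF PQ(1) T arr_cmp[OF bS(2) v(1)] arr_nul[OF o(1) D(1)]]
          cov_exact_inj[OF PQ(2) T arr_cmp[OF bS(4) v(1)] arr_nul[OF o(2) D(1)]]
          nul_cmp[OF bS(2) D(1)] nul_cmp[OF bS(4) D(1)] by simp_all
    qed
    moreover have "\<exists>u. arr S B u \<and> y \<cdot> u = w" if w: "arr S C w" for w
    proof -
      obtain a where a: "arr P B a" "y \<cdot> a = w \<cdot> i" using cov_exact_lift[OF PQ(1) T arr_cmp[OF bS(2) w]] .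
      obtain b where b: "arr Q B b" "y \<cdot> b = w \<cdot> j" using cov_exact_lift[OF PQ(2) T arr_cmp[OF bS(4) w]] .
      obtain u where u: "arr S B u" "u \<cdot> i = a" "u \<cdot> j = b" using biproduct_copair[OF S o a(1) b(1)] .
      have "y \<cdot> u = w"
        using biproduct_ext_from[OF S o arr_cmp[OF u(1) D(6)] w] assoc[OF bS(2) u(1) D(6)]
          assoc[OF bS(4) u(1) D(6)] u(2,3) a(2) b(2) by simp
      then show ?thesis using u(1) by blast
    qed
    ultimately show ?thesis using cov_exact_iff[OF et bS(1)] by blast
  qed
  then show ?thesis using bS(1) unfolding Proj_def by auto
qed

lemma contra_exact_sum:
  assumes t: "(A, x, B, y, C, \<delta>) \<in> \<xi>" "contra_exact \<C> W (A, x, B, y, C, \<delta>)"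
    and t': "(A', x', B', y', C', \<delta>') \<in> \<xi>" "contra_exact \<C> W (A', x', B', y', C', \<delta>')"
    and SA: "biproduct \<C> A A' SA iA pA jA qA" and SB: "biproduct \<C> B B' SB iB pB jB qB"
    and SC: "biproduct \<C> C C' SC iC pC jC qC" and W: "W \<in> Ob \<C>"
  shows "contra_exact \<C> W (SA, sum_mor \<C> SA pA qA SB iB jB x x', SB, sum_mor \<C> SB pB qB SC iC jC y y',
    SC, sum_ext \<C> SC pC qC SA iA jA \<delta> \<delta>')"
proof -
  note et = proper_etriangle[OF t(1)] and et' = proper_etriangle[OF t'(1)]
  note D = etriangleD[OF et] and D' = etriangleD[OF et']
  note bA = biproductD[OF SA D(1) D'(1)] and bB = biproductD[OF SB D(2) D'(2)]
    and bC = biproductD[OF SC D(3) D'(3)]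
  note X = sum_morD[OF SA D(1) D'(1) SB D(2) D'(2) D(5) D'(5)]
  note Y = sum_morD[OF SB D(2) D'(2) SC D(3) D'(3) D(6) D'(6)]
  let ?x = "sum_mor \<C> SA pA qA SB iB jB x x'" and ?y = "sum_mor \<C> SB pB qB SC iC jC y y'"
  note ce = t(2)[unfolded contra_exact_iff[OF et W]] and ce' = t'(2)[unfolded contra_exact_iff[OF et' W]]
  have "v = nul SC W" if v: "arr SC W v" "v \<cdot> ?y = nul SB W" for v
  proof (rule biproduct_ext_from[OF SC D(3) D'(3) v(1) arr_nul[OF bC(1) W]])
    have "(v \<cdot> iC) \<cdot> y = nul B W"
      using assoc[OF D(6) bC(2) v(1)] Y(2) assoc[OF bB(2) Y(1) v(1)] v(2) nul_cmp[OF bB(2) W] by simp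
    then show "v \<cdot> iC = nul SC W \<cdot> iC" using ce arr_cmp[OF bC(2) v(1)] nul_cmp[OF bC(2) W] by simp
    have "(v \<cdot> jC) \<cdot> y' = nul B' W"
      using assoc[OF D'(6) bC(4) v(1)] Y(3) assoc[OF bB(4) Y(1) v(1)] v(2) nul_cmp[OF bB(4) W] by simp
    then show "v \<cdot> jC = nul SC W \<cdot> jC" using ce' arr_cmp[OF bC(4) v(1)] nul_cmp[OF bC(4) W] by simp
  qed
  moreover have "\<exists>u. arr SB W u \<and> u \<cdot> ?x = w" if w: "arr SA W w" for w
  proof -
    obtain a where a: "arr B W a" "a \<cdot> x = w \<cdot> iA" using ce arr_cmp[OF bA(2) w] by blast
    obtain b where b: "arr B' W b" "b \<cdot> x' = w \<cdot> jA" using ce' arr_cmp[OF bA(4) w] by blast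
    obtain u where u: "arr SB W u" "u \<cdot> iB = a" "u \<cdot> jB = b"
      using biproduct_copair[OF SB D(2) D'(2) a(1) b(1)] .
    have "u \<cdot> ?x = w"
    proof (rule biproduct_ext_from[OF SA D(1) D'(1) arr_cmp[OF X(1) u(1)] w])
      show "(u \<cdot> ?x) \<cdot> iA = w \<cdot> iA"
        using assoc[OF bA(2) X(1) u(1)] X(2) assoc[OF D(5) bB(2) u(1)] u(2) a(2) by simp
      show "(u \<cdot> ?x) \<cdot> jA = w \<cdot> jA"
        using assoc[OF bA(4) X(1) u(1)] X(3) assoc[OF D'(5) bB(4) u(1)] u(3) b(2) by simp
    qed
    then show ?thesis using u(1) by blast
  qed
  ultimately show ?thesis
    using contra_exact_iff[OF proper_etriangle[OF coproduct_closed[OF t(1) t'(1) SA SB SC]] W] by blast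
qed

text \<open>Two Gorenstein projectives may occur at different places of their complexes; translation
  puts both at index 0, so that the complexes can be added degreewise.\<close>

lemma complete_projective_resolution_shift:
  assumes "complete_projective_resolution \<C> \<xi> X d K g f \<kappa>"
  shows "complete_projective_resolution \<C> \<xi> (\<lambda>n. X (n + k)) (\<lambda>n. d (n + k)) (\<lambda>n. K (n + k))
    (\<lambda>n. g (n + k)) (\<lambda>n. f (n + k)) (\<lambda>n. \<kappa> (n + k))"
proof -
  have *: "n - 1 + k = n + k - 1" "n - 2 + k = n + k - 2" "n + 1 + k = n + k + 1" for n by simp_all
  show ?thesis
    using assms unfolding complete_projective_resolution_def chain_complex_def
      resolution_triangles_def * by blast
qed

lemma GProjE:
  assumes "G \<in> GProj \<C> \<xi>"
  obtains X d K g f \<kappa> where "complete_projective_resolution \<C> \<xi> X d K g f \<kappa>" "K 0 = G"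
proof -
  obtain X d K g f \<kappa> n where r: "complete_projective_resolution \<C> \<xi> X d K g f \<kappa>" "G = K n"
    using assms unfolding GProj_def by blast
  from complete_projective_resolution_shift[OF r(1), of n] show ?thesis using that r(2) by force
qed

lemma GProj_Ob:
  assumes "G \<in> GProj \<C> \<xi>"
  shows "G \<in> Ob \<C>"
proof -
  obtain X d K g f \<kappa> where r: "complete_projective_resolution \<C> \<xi> X d K g f \<kappa>" "K 0 = G"
    using GProjE[OF assms] .
  then have "(K (0 + 1), g 0, X 0, f 0, K 0, \<kappa> 0) \<in> \<xi>"
    unfolding complete_projective_resolution_def resolution_triangles_def by blast
  from etriangleD(3)[OF proper_etriangle[OF this]] r(2) show ?thesis by simp
qed

lemma GProj_biproduct:
  assumes "G \<in> GProj \<C> \<xi>" "G' \<in> GProj \<C> \<xi>" and S: "biproduct \<C> G G' S i p j q"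
  shows "S \<in> GProj \<C> \<xi>"
proof -
  obtain X d K g f \<kappa> where r: "complete_projective_resolution \<C> \<xi> X d K g f \<kappa>" "K 0 = G"
    using GProjE[OF assms(1)] .
  obtain X' d' K' g' f' \<kappa>' where r': "complete_projective_resolution \<C> \<xi> X' d' K' g' f' \<kappa>'" "K' 0 = G'"
    using GProjE[OF assms(2)] .
  have t: "(K (n + 1), g n, X n, f n, K n, \<kappa> n) \<in> \<xi>" "(K' (n + 1), g' n, X' n, f' n, K' n, \<kappa>' n) \<in> \<xi>"
    and d: "d n = g (n - 1) \<cdot> f n" "d' n = g' (n - 1) \<cdot> f' n"
    and pr: "X n \<in> Proj \<C> \<xi>" "X' n \<in> Proj \<C> \<xi>"
    and ce: "W \<in> Proj \<C> \<xi> \<Longrightarrow> contra_exact \<C> W (K (n + 1), g n, X n, f n, K n, \<kappa> n)"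
      "W \<in> Proj \<C> \<xi> \<Longrightarrow> contra_exact \<C> W (K' (n + 1), g' n, X' n, f' n, K' n, \<kappa>' n)" for n W
    using r(1) r'(1) unfolding complete_projective_resolution_def resolution_triangles_def by blast+
  note D = etriangleD[OF proper_etriangle[OF t(1)]] and D' = etriangleD[OF proper_etriangle[OF t(2)]]
  obtain Y iX pX jX qX where Y: "biproduct \<C> (X n) (X' n) (Y n) (iX n) (pX n) (jX n) (qX n)" for n
    by (rule biproduct_family[of X X', OF D(2) D'(2)]) blast
  obtain L' i' p' j' q' where L': "biproduct \<C> (K n) (K' n) (L' n) (i' n) (p' n) (j' n) (q' n)" for n
    by (rule biproduct_family[of K K', OF D(3) D'(3)]) blast
  \<comment> \<open>The chosen sum at index 0 is overwritten by the given one, so that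
    \<open>S\<close> itself, and not just an isomorphic object, occurs in the complex.\<close>
  define L iK pK jK qK where "L = L'(0 := S)" "iK = i'(0 := i)" "pK = p'(0 := p)" "jK = j'(0 := j)"
    "qK = q'(0 := q)"
  then have L: "biproduct \<C> (K n) (K' n) (L n) (iK n) (pK n) (jK n) (qK n)" and L0: "L 0 = S" for n
    using L' S r(2) r'(2) by auto
  define h where "h n = sum_mor \<C> (L (n + 1)) (pK (n + 1)) (qK (n + 1)) (Y n) (iX n) (jX n) (g n) (g' n)" for n
  define k where "k n = sum_mor \<C> (Y n) (pX n) (qX n) (L n) (iK n) (jK n) (f n) (f' n)" for n
  define \<epsilon> where "\<epsilon> n = sum_ext \<C> (L n) (pK n) (qK n) (L (n + 1)) (iK (n + 1)) (jK (n + 1)) (\<kappa> n) (\<kappa>' n)" for n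
  have T: "(L (n + 1), h n, Y n, k n, L n, \<epsilon> n) \<in> \<xi>" for n
    unfolding h_def k_def \<epsilon>_def by (rule coproduct_closed[OF t L Y L])
  note E = etriangleD[OF proper_etriangle[OF T]]
  \<comment> \<open>The inflation indexed by n - 1 starts at \<open>L (n - 1 + 1)\<close>, which has
    to be recognized as \<open>L n\<close>.\<close>
  have h1: "arr (L n) (Y (n - 1)) (h (n - 1))" for n using E(5)[of "n - 1"] by simp
  have "(h (n - 1 - 1) \<cdot> k (n - 1)) \<cdot> (h (n - 1) \<cdot> k n) = nul (Y n) (Y (n - 2))" for n
  proof -
    have "k (n - 1) \<cdot> (h (n - 1) \<cdot> k n) = nul (Y n) (L (n - 1))"
      using assoc[OF E(6) h1 E(6), symmetric] etriangle_cmp[OF proper_etriangle[OF T[of "n - 1"]]]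
        nul_cmp[OF E(6) E(3)] by simp
    moreover have h2: "arr (L (n - 1)) (Y (n - 2)) (h (n - 2))" using E(5)[of "n - 2"] by simp
    ultimately show ?thesis
      using assoc[OF arr_cmp[OF E(6) h1] E(6) h2] cmp_nul[OF h2 E(2)] by simp
  qed
  then have "complete_projective_resolution \<C> \<xi> Y (\<lambda>n. h (n - 1) \<cdot> k n) L h k \<epsilon>"
    unfolding complete_projective_resolution_def chain_complex_def resolution_triangles_def
    using E(2) T arrD(3)[OF arr_cmp[OF E(6) h1]] Proj_biproduct[OF pr Y]
      contra_exact_sum[OF t(1) ce(1) t(2) ce(2) L Y L, folded h_def k_def \<epsilon>_def]
    by (auto simp: Proj_def)
  then show ?thesis using L0 unfolding GProj_def by blast
qed

section \<open>The horseshoe\<close>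

theorem horseshoe:
  assumes t: "(A, x, B, y, C, \<delta>) \<in> \<xi>" "\<forall>W \<in> GProj \<C> \<xi>. cov_exact \<C> W (A, x, B, y, C, \<delta>)"
    and resA: "proper_GProj_resolution \<C> \<xi> A GA dA" and resC: "proper_GProj_resolution \<C> \<xi> C GC dC"
  obtains P i p j q dB where "\<And>n. biproduct \<C> (GA n) (GC n) (P n) (i n) (p n) (j n) (q n)"
    "proper_GProj_resolution \<C> \<xi> B P dB" "chain_map \<C> GA dA P dB i" "chain_map \<C> P dB GC dC q"
    "dB 0 \<cdot> i 0 = x \<cdot> dA 0" "dC 0 \<cdot> q 0 = y \<cdot> dB 0"
proof -
  obtain KA gA fA \<alpha> where KA: "KA 0 = A" "dA 0 = fA 0" "dA (Suc n) = gA n \<cdot> fA (Suc n)"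
      "(KA (Suc n), gA n, GA n, fA n, KA n, \<alpha> n) \<in> \<xi>"
      "W \<in> GProj \<C> \<xi> \<Longrightarrow> cov_exact \<C> W (KA (Suc n), gA n, GA n, fA n, KA n, \<alpha> n)" for n W
    using resA unfolding proper_GProj_resolution_def by blast
  obtain KC gC fC \<gamma> where KC: "KC 0 = C" "dC 0 = fC 0" "dC (Suc n) = gC n \<cdot> fC (Suc n)"
      "(KC (Suc n), gC n, GC n, fC n, KC n, \<gamma> n) \<in> \<xi>"
      "W \<in> GProj \<C> \<xi> \<Longrightarrow> cov_exact \<C> W (KC (Suc n), gC n, GC n, fC n, KC n, \<gamma> n)" for n W
    using resC unfolding proper_GProj_resolution_def by blast
  have G: "GA n \<in> GProj \<C> \<xi>" "GC n \<in> GProj \<C> \<xi>" for n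
    using resA resC unfolding proper_GProj_resolution_def by auto
  note DA = etriangleD[OF proper_etriangle[OF KA(4)]] and DC = etriangleD[OF proper_etriangle[OF KC(4)]]
  obtain P i p j q where P: "biproduct \<C> (GA n) (GC n) (P n) (i n) (p n) (j n) (q n)" for n
    by (rule biproduct_family[of GA GC, OF DA(2) DC(2)]) blast
  \<comment> \<open>The state of the recursion: the middle object, both maps and the extension of
    the triangle between the n-th syzygies of \<open>A\<close> and \<open>C\<close>.
    \<open>column\<close> relates it to the next state by a vertical triangle and the four
    squares.\<close>
  define row where "row n s \<longleftrightarrow> (case s of (L, u, v, \<epsilon>) \<Rightarrow>
    (KA n, u, L, v, KC n, \<epsilon>) \<in> \<xi> \<and> (\<forall>W \<in> GProj \<C> \<xi>. cov_exact \<C> W (KA n, u, L, v, KC n, \<epsilon>)))" for n s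
  define column where "column n s s' g f \<beta> \<longleftrightarrow> (case s of (L, u, v, \<epsilon>) \<Rightarrow> case s' of (L', u', v', \<epsilon>') \<Rightarrow>
      (L', g, P n, f, L, \<beta>) \<in> \<xi> \<and> (\<forall>W \<in> GProj \<C> \<xi>. cov_exact \<C> W (L', g, P n, f, L, \<beta>)) \<and>
      g \<cdot> u' = i n \<cdot> gA n \<and> q n \<cdot> g = gC n \<cdot> v' \<and> f \<cdot> i n = u \<cdot> fA n \<and> v \<cdot> f = fC n \<cdot> q n)"
    for n and s s' :: "'o \<times> 'm \<times> 'm \<times> 'e" and g f \<beta>
  \<comment> \<open>Dependent choice. The clause at \<open>n = 0\<close> pins the first row to the
    given triangle, since the principle alone yields only some admissible start.\<close>
  have "\<exists>s. \<forall>n. (row n (s n) \<and> (n = 0 \<longrightarrow> s n = (B, x, y, \<delta>))) \<and> (\<exists>g f \<beta>. column n (s n) (s (Suc n)) g f \<beta>)"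
  proof (rule dependent_nat_choice)
    show "\<exists>s. row 0 s \<and> (0 = 0 \<longrightarrow> s = (B, x, y, \<delta>))"
      using t KA(1) KC(1) unfolding row_def by auto
  next
    fix s n
    assume "row n s \<and> (n = 0 \<longrightarrow> s = (B, x, y, \<delta>))"
    then obtain L u v \<epsilon> where s: "s = (L, u, v, \<epsilon>)" and r: "(KA n, u, L, v, KC n, \<epsilon>) \<in> \<xi>"
        "\<And>W. W \<in> GProj \<C> \<xi> \<Longrightarrow> cov_exact \<C> W (KA n, u, L, v, KC n, \<epsilon>)"
      unfolding row_def by (auto split: prod.splits)
    \<comment> \<open>The lift exists because \<open>GC n\<close> is Gorenstein projective and the
      current row is exact for such objects.\<close>
    obtain h where h: "arr (GC n) L h" "v \<cdot> h = fC n"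
      using cov_exact_lift[OF r(2)[OF G(2)] r(1) DC(6)] .
    obtain L' g f \<beta> u' v' \<epsilon>' where L': "(L', g, P n, f, L, \<beta>) \<in> \<xi>" "(KA (Suc n), u', L', v', KC (Suc n), \<epsilon>') \<in> \<xi>"
        "g \<cdot> u' = i n \<cdot> gA n" "q n \<cdot> g = gC n \<cdot> v'" "f \<cdot> i n = u \<cdot> fA n" "v \<cdot> f = fC n \<cdot> q n"
      using horseshoe_step[OF r(1) KA(4) KC(4) P h] by metis
    note ex = horseshoe_exact[OF r(1) r(2) KA(4) KA(5) KC(4) KC(5) P L' GProj_Ob]
    have "row (Suc n) (L', u', v', \<epsilon>')" "column n s (L', u', v', \<epsilon>') g f \<beta>"
      unfolding row_def column_def s using L' ex by auto
    then show "\<exists>s'. (row (Suc n) s' \<and> (Suc n = 0 \<longrightarrow> s' = (B, x, y, \<delta>))) \<and> (\<exists>g f \<beta>. column n s s' g f \<beta>)"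
      by blast
  qed
  then obtain s where s: "row n (s n)" "s 0 = (B, x, y, \<delta>)" "\<exists>g f \<beta>. column n (s n) (s (Suc n)) g f \<beta>" for n
    by metis
  then obtain g f \<beta> where col: "column n (s n) (s (Suc n)) (g n) (f n) (\<beta> n)" for n by metis
  define L u v where "L n = fst (s n)" and "u n = fst (snd (s n))" and "v n = fst (snd (snd (s n)))" for n
  have start: "L 0 = B" "u 0 = x" "v 0 = y" unfolding L_def u_def v_def s(2) by simp_all
  have T: "(L (Suc n), g n, P n, f n, L n, \<beta> n) \<in> \<xi>"
      "W \<in> GProj \<C> \<xi> \<Longrightarrow> cov_exact \<C> W (L (Suc n), g n, P n, f n, L n, \<beta> n)"
    and sq: "g n \<cdot> u (Suc n) = i n \<cdot> gA n" "q n \<cdot> g n = gC n \<cdot> v (Suc n)"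
      "f n \<cdot> i n = u n \<cdot> fA n" "v n \<cdot> f n = fC n \<cdot> q n" for n W
    using col[of n] unfolding column_def L_def u_def v_def by (auto split: prod.splits)
  have uv: "arr (KA n) (L n) (u n)" "arr (L n) (KC n) (v n)" for n
  proof -
    have "(KA n, u n, L n, v n, KC n, snd (snd (snd (s n)))) \<in> \<xi>"
      using s(1)[of n] unfolding row_def L_def u_def v_def by (auto split: prod.splits)
    then show "arr (KA n) (L n) (u n)" "arr (L n) (KC n) (v n)"
      using etriangleD(5,6) proper_etriangle by blast+
  qed
  note D = etriangleD[OF proper_etriangle[OF T(1)]]
  note bP = biproductD[OF P DA(2) DC(2)]
  have fg: "f n \<cdot> g n \<cdot> w = nul M (L n)" if w: "arr M (L (Suc n)) w" for n M w
    using assoc[OF w D(5,6)] etriangle_cmp[OF proper_etriangle[OF T(1)]] nul_cmp[OF w D(3)] by simp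
  \<comment> \<open>Degree 0 is the augmentation. In degree \<open>Suc m\<close>, the deflation
    \<open>f (Suc m)\<close> ends at \<open>L (Suc m)\<close>, the fiber of \<open>f m\<close>, from
    which \<open>g m\<close> leads to \<open>P m\<close>.\<close>
  define dB where "dB n = (case n of 0 \<Rightarrow> f 0 | Suc m \<Rightarrow> g m \<cdot> f (Suc m))" for n
  have dB: "dB 0 = f 0" "dB (Suc n) = g n \<cdot> f (Suc n)" for n by (simp_all add: dB_def)
  have "augmented_complex \<C> B P dB"
    unfolding augmented_complex_def One_nat_def dB
  proof (intro conjI allI)
    show "B \<in> Ob \<C>" "f 0 \<in> mor \<C> (P 0) B" using D(3)[of 0] arrD(3)[OF D(6)[of 0]] start by simp_all
    show "P n \<in> Ob \<C>" for n using D(2) .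
    show "g n \<cdot> f (Suc n) \<in> mor \<C> (P (Suc n)) (P n)" for n using arrD(3)[OF arr_cmp[OF D(6) D(5)]] .
    show "f 0 \<cdot> g 0 \<cdot> f (Suc 0) = nul (P (Suc 0)) B" using fg[OF D(6)] start by simp
    show "(g n \<cdot> f (Suc n)) \<cdot> g (Suc n) \<cdot> f (Suc (Suc n)) = nul (P (Suc (Suc n))) (P n)" for n
      using assoc[OF arr_cmp[OF D(6,5)] D(6,5)] fg[OF D(6)] cmp_nul[OF D(5) D(2)] by simp
  qed
  then have "proper_GProj_resolution \<C> \<xi> B P dB"
    unfolding proper_GProj_resolution_def
    using GProj_biproduct[OF G P] T start dB by blast
  \<comment> \<open>Both chain maps paste two squares, passing through the row maps \<open>u\<close>
    and \<open>v\<close> between the syzygies.\<close>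
  moreover have "chain_map \<C> GA dA P dB i"
    unfolding chain_map_def KA(3) dB
    using arrD(3)[OF bP(2)] assoc[OF bP(2) D(6,5)] sq(3) assoc[OF DA(6) uv(1) D(5)] sq(1)
      assoc[OF DA(6,5) bP(2)] by simp
  moreover have "chain_map \<C> P dB GC dC q"
    unfolding chain_map_def KC(3) dB
    using arrD(3)[OF bP(5)] assoc[OF bP(5) DC(6,5)] sq(4)[symmetric] assoc[OF D(6) uv(2) DC(5)]
      sq(2)[symmetric] assoc[OF D(6,5) bP(5)] by simp
  moreover have "dB 0 \<cdot> i 0 = x \<cdot> dA 0" "dC 0 \<cdot> q 0 = y \<cdot> dB 0"
    using sq(3,4)[of 0] start dB KA(2) KC(2) by simp_all
  ultimately show ?thesis using that[OF P] by blast
qed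

end

section \<open>The horseshoe lemma with degreewise split rows\<close>

theorem lemma3p5:
  fixes \<C> :: "('o, 'm, 'e) extri_cat" (structure)
    and \<xi> :: "('o, 'm, 'e) tri set"
    and A B C :: 'o and x y :: 'm and \<delta> :: 'e
    and G\<^sub>A G\<^sub>C :: "nat \<Rightarrow> 'o" and d\<^sub>A d\<^sub>C :: "nat \<Rightarrow> 'm"
  assumes "extriangulated_category \<C>"
    and "WIC \<C>"
    and "proper_class \<C> \<xi>"
    and "enough_projectives \<C> \<xi>"
    and "enough_injectives \<C> \<xi>"
    and "(A, x, B, y, C, \<delta>) \<in> \<xi>"
    and "\<forall>W \<in> GProj \<C> \<xi>. cov_exact \<C> W (A, x, B, y, C, \<delta>)"
    and "proper_GProj_resolution \<C> \<xi> A G\<^sub>A d\<^sub>A"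
    and "proper_GProj_resolution \<C> \<xi> C G\<^sub>C d\<^sub>C"
  shows "\<exists>G\<^sub>B d\<^sub>B xs ys.
           proper_GProj_resolution \<C> \<xi> B G\<^sub>B d\<^sub>B \<and>
           chain_map \<C> G\<^sub>A d\<^sub>A G\<^sub>B d\<^sub>B xs \<and> chain_map \<C> G\<^sub>B d\<^sub>B G\<^sub>C d\<^sub>C ys \<and>
           d\<^sub>B 0 \<cdot> xs 0 = x \<cdot> d\<^sub>A 0 \<and> d\<^sub>C 0 \<cdot> ys 0 = y \<cdot> d\<^sub>B 0 \<and>
           (\<forall>n. (\<exists>\<sigma>. (G\<^sub>A n, xs n, G\<^sub>B n, ys n, G\<^sub>C n, \<sigma>) \<in> etriangles \<C> \<and>
                     split \<C> (G\<^sub>A n, xs n, G\<^sub>B n, ys n, G\<^sub>C n, \<sigma>)) \<and>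
                (\<forall>P i p j q. biproduct \<C> (G\<^sub>A n) (G\<^sub>C n) P i p j q \<longrightarrow> isomorphic \<C> (G\<^sub>B n) P))"
proof -
  interpret proper_class \<C> \<xi> by fact
  obtain P i p j q dB where
    P: "\<And>n. biproduct \<C> (G\<^sub>A n) (G\<^sub>C n) (P n) (i n) (p n) (j n) (q n)" and
    res: "proper_GProj_resolution \<C> \<xi> B P dB" "chain_map \<C> G\<^sub>A d\<^sub>A P dB i" "chain_map \<C> P dB G\<^sub>C d\<^sub>C q"
      "dB 0 \<cdot> i 0 = x \<cdot> d\<^sub>A 0" "d\<^sub>C 0 \<cdot> q 0 = y \<cdot> dB 0"
    by (rule horseshoe[OF assms(6-9)]) blast
  have G: "G\<^sub>A n \<in> Ob \<C>" "G\<^sub>C n \<in> Ob \<C>" for n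
    using assms(8,9) GProj_Ob unfolding proper_GProj_resolution_def by blast+
  \<comment> \<open>The chain maps are the injections and projections of chosen biproducts, so the
    zero extension is realized in every degree.\<close>
  have "(G\<^sub>A n, i n, P n, q n, G\<^sub>C n, \<one>\<^bsub>Ext \<C> (G\<^sub>C n) (G\<^sub>A n)\<^esub>) \<in> etriangles \<C> \<and>
      split \<C> (G\<^sub>A n, i n, P n, q n, G\<^sub>C n, \<one>\<^bsub>Ext \<C> (G\<^sub>C n) (G\<^sub>A n)\<^esub>)" for n
    using etriangle_biproduct[OF P G] by (simp add: split_def)
  \<comment> \<open>The chosen sum is compared with an arbitrary one, which makes the isomorphism
    independent of the choice.\<close>
  moreover have "isomorphic \<C> (P n) P'" if "biproduct \<C> (G\<^sub>A n) (G\<^sub>C n) P' i' p' j' q'" for n P' i' p' j' q'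
    using biproduct_unique[OF P that G] .
  ultimately show ?thesis using res by blast
qed

end
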